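(* Let $p>1$ and let $u$ be a smooth, rapidly decaying axisymmetric solution of the three-dimensional incompressible Navier--Stokes equations with viscosity $\nu>0$ on $\mathbb R^3\times I$, $I$ an open time interval. Set $F=u^\theta/r$ and $\Gamma=ru^\theta=r^2F$. Then $$\int|F|^pr^{2p+1}\,dr\,dz=\int|\Gamma|^pr\,dr\,dz$$ and $$\frac{4(p-1)}{p^2}\int\big|\nabla|F|^{p/2}\big|^2r^{2p+1}\,dr\,dz-4(p-1)\int|F|^pr^{2p-1}\,dr\,dz=\frac{4(p-1)}{p^2}\int\big|\nabla|\Gamma|^{p/2}\big|^2r\,dr\,dz .$$ Consequently, the weighted swirl-rate energy identity recalled in the context, at $\alpha=2p+1$, is exactly the $L^p$ circulation identity $$\frac1p\frac{d}{dt}\int|\Gamma|^pr\,dr\,dz+\nu\frac{4(p-1)}{p^2}\int\big|\nabla|\Gamma|^{p/2}\big|^2r\,dr\,dz=0 .$$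
   Context: Cylindrical coordinates $(r,\theta,z)$ on $\mathbb R^3$; $u=u^r(r,z,t)e_r+u^\theta(r,z,t)e_\theta+u^z(r,z,t)e_z$. All integrals are over $(r,z)\in(0,\infty)\times\mathbb R$ (the factor $2\pi$ is dropped) and $\nabla=(\partial_r,\partial_z)$. ``Smooth rapidly decaying'' means that $u$ is smooth as a Cartesian vector field, including across the axis, and that $u$ and its derivatives decay faster than any power of $|x|$, locally uniformly in $t$. At the axis $F=O(1)$ and $\Gamma=O(r^2)$ (Cartesian pole conditions). The circulation satisfies $\Gamma_t+u^r\Gamma_r+u^z\Gamma_z=\nu(\Gamma_{rr}-\frac1r\Gamma_r+\Gamma_{zz})$, and incompressibility reads $\partial_ru^r+\frac{u^r}{r}+\partial_zu^z=0$. The weighted swirl-rate energy identity is, for $\alpha>1$, $U=u^r/r$ and $H=|F|^{p/2}$, $$\frac1p\frac{d}{dt}\int|F|^pr^\alpha\,dr\,dz+\nu\frac{4(p-1)}{p^2}\int|\nabla H|^2r^\alpha\,dr\,dz+\nu\frac{(3-\alpha)(\alpha-1)}p\int H^2r^{\alpha-2}\,dr\,dz=\frac{\alpha-(2p+1)}p\int U|F|^pr^\alpha\,dr\,dz .$$ For $1<p<2$ gradients of $|F|^{p/2}$ and $|\Gamma|^{p/2}$ are understood almost everywhere / in the Sobolev sense. *)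

theory Defs
  imports "HOL-Analysis.Analysis"
begin

section \<open>Smooth, rapidly decaying Navier--Stokes solutions\<close>

text \<open>Fields on space-time are functions of a pair (position, time).\<close>

definition dderiv ::
  "'a::real_normed_vector \<Rightarrow> ('a \<Rightarrow> 'b::real_normed_vector) \<Rightarrow> 'a \<Rightarrow> 'b" where
  "dderiv v f z = frechet_derivative f (at z) v"

abbreviation dspace ::
  "3 \<Rightarrow> ((real^3) \<times> real \<Rightarrow> 'b::real_normed_vector) \<Rightarrow> (real^3) \<times> real \<Rightarrow> 'b" where
  "dspace i \<equiv> dderiv (axis i 1, 0)"

abbreviation dtime ::
  "((real^3) \<times> real \<Rightarrow> 'b::real_normed_vector) \<Rightarrow> (real^3) \<times> real \<Rightarrow> 'b" where
  "dtime \<equiv> dderiv (0, 1)"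

text \<open>For open \<open>S\<close> this is \<open>C\<^sup>\<infinity>\<close> on \<open>S\<close>: every iterated directional derivative is itself
  (Frechet) differentiable, hence continuous, on \<open>S\<close>.\<close>

definition smooth_on_open ::
  "'a::real_normed_vector set \<Rightarrow> ('a \<Rightarrow> 'b::real_normed_vector) \<Rightarrow> bool" where
  "smooth_on_open S f \<longleftrightarrow> (\<forall>vs. \<forall>z\<in>S. foldr dderiv vs f differentiable (at z))"

text \<open>Only spatial derivatives are required to decay.\<close>

definition rapidly_decaying ::
  "real set \<Rightarrow> ((real^3) \<times> real \<Rightarrow> real^3) \<Rightarrow> bool" where
  "rapidly_decaying I u \<longleftrightarrow>
     (\<forall>(vs::(real^3) list) (N::nat) K. compact K \<and> K \<subseteq> I \<longrightarrow>
        (\<exists>C. \<forall>x. \<forall>t\<in>K. norm x ^ N * norm (foldr dderiv (map (\<lambda>v. (v, 0)) vs) u (x, t)) \<le> C))"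

text \<open>\<open>u\<^sub>t + (u \<cdot> \<nabla>)u = - \<nabla>\<pi> + \<nu> \<Delta>u\<close> and \<open>div u = 0\<close> on \<open>\<real>\<^sup>3 \<times> I\<close>, with some smooth
  pressure \<open>\<pi>\<close>.\<close>

definition navier_stokes ::
  "real \<Rightarrow> real set \<Rightarrow> ((real^3) \<times> real \<Rightarrow> real^3) \<Rightarrow> bool" where
  "navier_stokes \<nu> I u \<longleftrightarrow>
     (\<exists>\<pi> :: (real^3) \<times> real \<Rightarrow> real. smooth_on_open (UNIV \<times> I) \<pi> \<and>
        (\<forall>x. \<forall>t\<in>I.
           dtime u (x, t) + (\<Sum>i\<in>UNIV. (u (x, t) $ i) *\<^sub>R dspace i u (x, t))
             = - (\<chi> i. dspace i \<pi> (x, t)) + \<nu> *\<^sub>R (\<Sum>i\<in>UNIV. dspace i (dspace i u) (x, t)) \<and>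
           (\<Sum>i\<in>UNIV. dspace i u (x, t) $ i) = 0))"

section \<open>Axisymmetry\<close>

definition cyl :: "real \<Rightarrow> real \<Rightarrow> real \<Rightarrow> real^3" where
  "cyl r \<theta> z = vector [r * cos \<theta>, r * sin \<theta>, z]"

definition e_rad :: "real \<Rightarrow> real^3" where
  "e_rad \<theta> = vector [cos \<theta>, sin \<theta>, 0]"

definition e_ang :: "real \<Rightarrow> real^3" where
  "e_ang \<theta> = vector [- sin \<theta>, cos \<theta>, 0]"

definition e_vert :: "real^3" where
  "e_vert = vector [0, 0, 1]"

text \<open>\<open>u\<close> has the \<open>\<theta>\<close>-independent cylindrical components \<open>ur\<close>, \<open>uth\<close>, \<open>uz\<close>, which are functions
  of \<open>r\<close>, \<open>z\<close>, \<open>t\<close> in this order; their values for \<open>r \<le> 0\<close> are irrelevant.\<close>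

definition axisymmetric_components ::
  "real set \<Rightarrow> ((real^3) \<times> real \<Rightarrow> real^3) \<Rightarrow>
   (real \<Rightarrow> real \<Rightarrow> real \<Rightarrow> real) \<Rightarrow> (real \<Rightarrow> real \<Rightarrow> real \<Rightarrow> real) \<Rightarrow>
   (real \<Rightarrow> real \<Rightarrow> real \<Rightarrow> real) \<Rightarrow> bool" where
  "axisymmetric_components I u ur uth uz \<longleftrightarrow>
     (\<forall>r>0. \<forall>\<theta> z. \<forall>t\<in>I. u (cyl r \<theta> z, t) =
        ur r z t *\<^sub>R e_rad \<theta> + uth r z t *\<^sub>R e_ang \<theta> + uz r z t *\<^sub>R e_vert)"

definition swirl_rate ::
  "(real \<Rightarrow> real \<Rightarrow> real \<Rightarrow> real) \<Rightarrow> real \<Rightarrow> real \<Rightarrow> real \<Rightarrow> real" where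
  "swirl_rate uth r z t = uth r z t / r"

definition circulation ::
  "(real \<Rightarrow> real \<Rightarrow> real \<Rightarrow> real) \<Rightarrow> real \<Rightarrow> real \<Rightarrow> real \<Rightarrow> real" where
  "circulation uth r z t = r * uth r z t"

lemma circulation_eq_swirl_rate:
  "r > 0 \<Longrightarrow> circulation uth r z t = r\<^sup>2 * swirl_rate uth r z t"
  by (simp add: circulation_def swirl_rate_def power2_eq_square)

section \<open>Integrals and gradients on the meridional half-plane\<close>

definition half_plane :: "(real \<times> real) set" where
  "half_plane = {0<..} \<times> UNIV"

definition hp_integrable :: "(real \<Rightarrow> real \<Rightarrow> real) \<Rightarrow> bool" where
  "hp_integrable f \<longleftrightarrow> set_integrable lebesgue half_plane (\<lambda>(r, z). f r z)"

definition hp_integral :: "(real \<Rightarrow> real \<Rightarrow> real) \<Rightarrow> real" where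
  "hp_integral f = set_lebesgue_integral lebesgue half_plane (\<lambda>(r, z). f r z)"

definition hp_ae_differentiable :: "(real \<Rightarrow> real \<Rightarrow> real) \<Rightarrow> bool" where
  "hp_ae_differentiable f \<longleftrightarrow>
     (AE x in lebesgue. x \<in> half_plane \<longrightarrow> (\<lambda>(r, z). f r z) differentiable (at x))"

text \<open>\<open>\<nabla> = (\<partial>\<^sub>r, \<partial>\<^sub>z)\<close>, meaningful only where \<open>f\<close> is differentiable; the value elsewhere is
  arbitrary, so an integral of \<open>hp_grad f\<close> has its intended meaning when
  \<open>hp_ae_differentiable f\<close> holds. The norm on pairs is Euclidean.\<close>

definition hp_grad :: "(real \<Rightarrow> real \<Rightarrow> real) \<Rightarrow> real \<Rightarrow> real \<Rightarrow> real \<times> real" where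
  "hp_grad f r z = (deriv (\<lambda>s. f s z) r, deriv (\<lambda>s. f r s) z)"

text \<open>\<open>|f(r, z, t)|\<^sup>q\<close> at a fixed time \<open>t\<close>.\<close>

definition abs_pow ::
  "(real \<Rightarrow> real \<Rightarrow> real \<Rightarrow> real) \<Rightarrow> real \<Rightarrow> real \<Rightarrow> real \<Rightarrow> real \<Rightarrow> real" where
  "abs_pow f q t r z = \<bar>f r z t\<bar> powr q"

section \<open>The two sides of the energy identities\<close>

text \<open>The weighted swirl-rate energy identity at time \<open>t\<close> is
  \<open>weighted_swirl_lhs \<nu> p \<alpha> uth t = weighted_swirl_rhs p \<alpha> ur uth t\<close>, with \<open>F = u\<^sup>\<theta>/r\<close>,
  \<open>H = |F|\<^sup>p\<^sup>/\<^sup>2\<close>, \<open>U = u\<^sup>r/r\<close>. The time derivatives are given by \<open>deriv\<close>, so differentiability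
  has to be asserted separately.\<close>

definition weighted_swirl_lhs ::
  "real \<Rightarrow> real \<Rightarrow> real \<Rightarrow> (real \<Rightarrow> real \<Rightarrow> real \<Rightarrow> real) \<Rightarrow> real \<Rightarrow> real" where
  "weighted_swirl_lhs \<nu> p \<alpha> uth t =
     (let F = swirl_rate uth; H = abs_pow F (p / 2) t in
        1 / p * deriv (\<lambda>s. hp_integral (\<lambda>r z. abs_pow F p s r z * r powr \<alpha>)) t
        + \<nu> * (4 * (p - 1) / p\<^sup>2) * hp_integral (\<lambda>r z. (norm (hp_grad H r z))\<^sup>2 * r powr \<alpha>)
        + \<nu> * ((3 - \<alpha>) * (\<alpha> - 1) / p) * hp_integral (\<lambda>r z. (H r z)\<^sup>2 * r powr (\<alpha> - 2)))"

definition weighted_swirl_rhs ::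
  "real \<Rightarrow> real \<Rightarrow> (real \<Rightarrow> real \<Rightarrow> real \<Rightarrow> real) \<Rightarrow> (real \<Rightarrow> real \<Rightarrow> real \<Rightarrow> real) \<Rightarrow> real \<Rightarrow> real" where
  "weighted_swirl_rhs p \<alpha> ur uth t =
     (\<alpha> - (2 * p + 1)) / p *
       hp_integral (\<lambda>r z. ur r z t / r * abs_pow (swirl_rate uth) p t r z * r powr \<alpha>)"

text \<open>The \<open>L\<^sup>p\<close> circulation identity at time \<open>t\<close> is \<open>circulation_lhs \<nu> p uth t = 0\<close>.\<close>

definition circulation_lhs ::
  "real \<Rightarrow> real \<Rightarrow> (real \<Rightarrow> real \<Rightarrow> real \<Rightarrow> real) \<Rightarrow> real \<Rightarrow> real" where
  "circulation_lhs \<nu> p uth t =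
     (let \<Gamma> = circulation uth in
        1 / p * deriv (\<lambda>s. hp_integral (\<lambda>r z. abs_pow \<Gamma> p s r z * r)) t
        + \<nu> * (4 * (p - 1) / p\<^sup>2) *
            hp_integral (\<lambda>r z. (norm (hp_grad (abs_pow \<Gamma> (p / 2) t) r z))\<^sup>2 * r))"

end

theory Submission
  imports Defs "HOL-Probability.Sinc_Integral"
begin

text \<open>
  The two quantities differ by a power of the radius, \<open>\<Gamma> = r\<^sup>2 F\<close>, so \<open>|F|\<^sup>p r\<^sup>2\<^sup>p\<^sup>+\<^sup>1 = |\<Gamma>|\<^sup>p r\<close>
  pointwise. For \<open>G = |\<Gamma>|\<^sup>p\<^sup>/\<^sup>2 = r\<^sup>p |F|\<^sup>p\<^sup>/\<^sup>2\<close>, expanding the gradient of \<open>r\<^sup>-\<^sup>p G\<close> leaves, besides the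
  gradient of \<open>G\<close> and a multiple of \<open>G\<^sup>2 / r = |F|\<^sup>p r\<^sup>2\<^sup>p\<^sup>-\<^sup>1\<close>, only the perfect derivative
  \<open>- p \<partial>\<^sub>r |\<Gamma>|\<^sup>p\<close> (lemma \<open>swirl_rate_gradient\<close>). Its integral is zero because \<open>\<Gamma>\<close> vanishes on the
  axis. This is the exchange of the two dissipation terms, and it accounts for the coefficient
  \<open>(3 - \<alpha>)(\<alpha> - 1) / p = - 4 (p - 1)\<close> at \<open>\<alpha> = 2 p + 1\<close>, the exponent at which the stretching term
  on the right has coefficient zero.

  The circulation identity itself is the circulation equation tested with \<open>|\<Gamma>|\<^sup>p\<^sup>-\<^sup>2 \<Gamma>\<close>. Diffusion yields
  the dissipation (\<open>power_green\<close>), the term \<open>- 2 \<nu> \<Gamma>\<^sub>r / r\<close> and the transport term are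
  divergences (\<open>radial_power_derivative_integral\<close>, \<open>transport_integral\<close>), and the time derivative
  passes under the integral because the equation expresses \<open>\<Gamma>\<^sub>t\<close> by decaying space derivatives
  (\<open>power_integral_derivative\<close>).

  Two points carry the difficulty. For \<open>p < 2\<close> the weight \<open>|\<Gamma>|\<^sup>p\<^sup>-\<^sup>2\<close> is singular on the zero set.
  There \<open>\<nabla>\<Gamma> = 0\<close> almost everywhere (\<open>AE_critical_zeros\<close>), and at such points \<open>|\<Gamma>|\<^sup>p\<^sup>/\<^sup>2\<close> is
  differentiable with derivative zero (\<open>half_power_has_derivative\<close>); the integrability of the
  dissipation is obtained together with Green's identity, by regularising the power and passing to
  the limit with Fatou's lemma. Secondly, the circulation equation has to be derived from the
  Cartesian system without any decay or symmetry of the pressure: the torque exerted by the pressure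
  is constant along circles about the axis, by equivariance of all the other terms, and its integral
  over a full circle is zero (\<open>swirl_force_zero\<close>).
\<close>

section \<open>Rapidly decreasing families on the plane\<close>

text \<open>The index \<open>k\<close> is a time. Decay is asked for uniformly in \<open>k \<in> K\<close> because differentiation of an
  integral with respect to time needs one integrable majorant for a whole neighbourhood of times;
  continuity is asked for in the space variable only.\<close>

definition rapid :: "'k set \<Rightarrow> ('k \<Rightarrow> real \<times> real \<Rightarrow> real) \<Rightarrow> bool" where
  "rapid K f \<longleftrightarrow> (\<forall>k\<in>K. continuous_on UNIV (f k)) \<and>
     (\<forall>N. \<exists>C. \<forall>k\<in>K. \<forall>x. (1 + norm x) ^ N * \<bar>f k x\<bar> \<le> C)"

abbreviation rapid1 :: "(real \<times> real \<Rightarrow> real) \<Rightarrow> bool" where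
  "rapid1 f \<equiv> rapid {()} (\<lambda>_. f)"

lemma rapid1: "rapid K f \<Longrightarrow> k \<in> K \<Longrightarrow> rapid1 (f k)"
  unfolding rapid_def by blast

lemma rapidI:
  assumes "\<And>k. k \<in> K \<Longrightarrow> continuous_on UNIV (f k)"
    and "\<And>N. \<exists>C. \<forall>k\<in>K. \<forall>x. (1 + norm x) ^ N * \<bar>f k x\<bar> \<le> C"
  shows "rapid K f"
  using assms by (auto simp: rapid_def)

lemma rapid_continuous: "rapid K f \<Longrightarrow> k \<in> K \<Longrightarrow> continuous_on UNIV (f k)"
  by (simp add: rapid_def)

lemma rapid_bound:
  assumes "rapid K f"
  obtains C where "C \<ge> 0" "\<And>k x. k \<in> K \<Longrightarrow> \<bar>f k x\<bar> \<le> C / (1 + norm x) ^ N"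
proof -
  obtain C where C: "\<And>k x. k \<in> K \<Longrightarrow> (1 + norm x) ^ N * \<bar>f k x\<bar> \<le> C"
    using assms unfolding rapid_def by metis
  have "\<bar>f k x\<bar> \<le> max C 0 / (1 + norm x) ^ N" if "k \<in> K" for k x
  proof -
    have "0 < (1 + norm x) ^ N"
      by (simp add: add_pos_nonneg)
    moreover have "(1 + norm x) ^ N * \<bar>f k x\<bar> \<le> max C 0"
      using C[OF that, of x] by simp
    ultimately show ?thesis
      by (simp add: field_simps)
  qed
  then show ?thesis
    using that[of "max C 0"] by simp
qed

lemma rapid1_bound:
  assumes "rapid1 f"
  obtains C where "\<And>x. \<bar>f x\<bar> \<le> C / (1 + norm x) ^ N"
  by (rule rapid_bound[OF assms, of N]) (rule that, simp)

lemma rapid_bounded: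
  assumes "rapid K f"
  obtains C where "C \<ge> 0" "\<And>k x. k \<in> K \<Longrightarrow> \<bar>f k x\<bar> \<le> C"
  using rapid_bound[OF assms, of 0] by auto

lemma rapid_add:
  assumes "rapid K f" "rapid K g"
  shows "rapid K (\<lambda>k x. f k x + g k x)"
proof (rule rapidI)
  fix N
  obtain C D where C: "\<And>k x. k \<in> K \<Longrightarrow> (1 + norm x) ^ N * \<bar>f k x\<bar> \<le> C"
    and D: "\<And>k x. k \<in> K \<Longrightarrow> (1 + norm x) ^ N * \<bar>g k x\<bar> \<le> D"
    using assms unfolding rapid_def by metis
  have "(1 + norm x) ^ N * \<bar>f k x + g k x\<bar> \<le> C + D" if "k \<in> K" for k x
  proof -
    have "(1 + norm x) ^ N * \<bar>f k x + g k x\<bar> \<le> (1 + norm x) ^ N * (\<bar>f k x\<bar> + \<bar>g k x\<bar>)"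
      by (intro mult_left_mono) auto
    then show ?thesis
      using C[OF that, of x] D[OF that, of x] by (simp add: distrib_left)
  qed
  then show "\<exists>C. \<forall>k\<in>K. \<forall>x. (1 + norm x) ^ N * \<bar>f k x + g k x\<bar> \<le> C"
    by blast
qed (use assms in \<open>auto intro!: continuous_intros simp: rapid_def\<close>)

lemma rapid_mult_poly:
  assumes f: "rapid K f"
    and b: "\<And>k. k \<in> K \<Longrightarrow> continuous_on UNIV (b k)"
    and B: "\<And>k x. k \<in> K \<Longrightarrow> \<bar>b k x\<bar> \<le> B * (1 + norm x) ^ m"
  shows "rapid K (\<lambda>k x. b k x * f k x)"
proof (rule rapidI)
  fix N
  obtain C where C: "\<And>k x. k \<in> K \<Longrightarrow> (1 + norm x) ^ (N + m) * \<bar>f k x\<bar> \<le> C"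
    using f unfolding rapid_def by metis
  have "(1 + norm x) ^ N * \<bar>b k x * f k x\<bar> \<le> \<bar>B\<bar> * C" if "k \<in> K" for k x
  proof -
    have "\<bar>b k x\<bar> \<le> \<bar>B\<bar> * (1 + norm x) ^ m"
      using B[OF that, of x] by (rule order_trans) (simp add: mult_right_mono)
    then have "(1 + norm x) ^ N * (\<bar>b k x\<bar> * \<bar>f k x\<bar>)
        \<le> (1 + norm x) ^ N * (\<bar>B\<bar> * (1 + norm x) ^ m * \<bar>f k x\<bar>)"
      by (intro mult_left_mono mult_right_mono) auto
    also have "\<dots> = \<bar>B\<bar> * ((1 + norm x) ^ (N + m) * \<bar>f k x\<bar>)"
      by (simp add: power_add mult_ac)
    also have "\<dots> \<le> \<bar>B\<bar> * C"
      using C[OF that] by (intro mult_left_mono) auto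
    finally show ?thesis
      by (simp add: abs_mult)
  qed
  then show "\<exists>C. \<forall>k\<in>K. \<forall>x. (1 + norm x) ^ N * \<bar>b k x * f k x\<bar> \<le> C"
    by blast
qed (use assms in \<open>auto intro!: continuous_intros simp: rapid_def\<close>)

lemma rapid_cmult: "rapid K f \<Longrightarrow> rapid K (\<lambda>k x. c * f k x)"
  by (rule rapid_mult_poly[where B = "\<bar>c\<bar>" and m = 0]) auto

lemma rapid_uminus: "rapid K f \<Longrightarrow> rapid K (\<lambda>k x. - f k x)"
  using rapid_cmult[of K f "-1"] by simp

lemma rapid_diff: "rapid K f \<Longrightarrow> rapid K g \<Longrightarrow> rapid K (\<lambda>k x. f k x - g k x)"
  using rapid_add[OF _ rapid_uminus, of K f g] by simp

lemma rapid_mult_fst: "rapid K f \<Longrightarrow> rapid K (\<lambda>k x. fst x * f k x)"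
proof (rule rapid_mult_poly[where B = 1 and m = 1])
  show "\<bar>fst x\<bar> \<le> 1 * (1 + norm x) ^ 1" for x :: "real \<times> real"
    using norm_fst_le[of "fst x" "snd x"] by simp
qed (auto intro!: continuous_intros)

lemma rapid_mult:
  assumes "rapid K f" "rapid K g"
  shows "rapid K (\<lambda>k x. f k x * g k x)"
proof -
  obtain B where "\<And>k x. k \<in> K \<Longrightarrow> \<bar>f k x\<bar> \<le> B"
    using rapid_bounded[OF assms(1)] by metis
  then show ?thesis
    using assms rapid_continuous[OF assms(1)]
    by (intro rapid_mult_poly[where B = B and m = 0]) auto
qed

text \<open>A rapidly decreasing family takes its values in one compact interval, on which \<open>\<psi>\<close> is
  bounded. Products with \<open>\<psi>(g)\<close> therefore stay rapidly decreasing however \<open>\<psi>\<close> grows.\<close>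

lemma rapid_compose_bounded:
  fixes \<psi> :: "real \<Rightarrow> real"
  assumes "continuous_on UNIV \<psi>" and "rapid K g"
  obtains B where "\<And>k x. k \<in> K \<Longrightarrow> \<bar>\<psi> (g k x)\<bar> \<le> B"
proof -
  obtain C where C: "\<And>k x. k \<in> K \<Longrightarrow> \<bar>g k x\<bar> \<le> C"
    using rapid_bounded[OF assms(2)] by metis
  have "compact (\<psi> ` {-C..C})"
    using assms(1) by (intro compact_continuous_image) (auto intro: continuous_on_subset)
  then obtain B where B: "\<And>y. y \<in> {-C..C} \<Longrightarrow> norm (\<psi> y) \<le> B"
    by (metis compact_imp_bounded bounded_iff image_eqI)
  show ?thesis
  proof (rule that[of B])
    fix k x assume "k \<in> K"
    then have "g k x \<in> {-C..C}"
      using C[of k x] by (auto simp: abs_le_iff)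
    then show "\<bar>\<psi> (g k x)\<bar> \<le> B"
      using B by fastforce
  qed
qed

lemma rapid_mult_compose:
  fixes \<psi> :: "real \<Rightarrow> real"
  assumes "continuous_on UNIV \<psi>" and "rapid K g" and "rapid K f"
  shows "rapid K (\<lambda>k x. \<psi> (g k x) * f k x)"
proof -
  obtain B where "\<And>k x. k \<in> K \<Longrightarrow> \<bar>\<psi> (g k x)\<bar> \<le> B"
    using rapid_compose_bounded[OF assms(1,2)] by metis
  moreover have "continuous_on UNIV (\<lambda>x. \<psi> (g k x))" if "k \<in> K" for k
    using continuous_on_compose2[OF assms(1) rapid_continuous[OF assms(2) that]] by simp
  ultimately show ?thesis
    using assms by (intro rapid_mult_poly[where B = B and m = 0]) auto
qed

text \<open>A polynomial weight of order four dominates \<open>(1 + r\<^sup>2)(1 + z\<^sup>2)\<close>, whose reciprocal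
  is integrable by Fubini and the arctangent integral.\<close>

lemma integrable_plane_weight:
  "integrable lborel (\<lambda>x :: real \<times> real. 1 / (1 + norm x) ^ 4)"
proof -
  have one: "integrable lborel (\<lambda>x::real. 1 / (1 + x\<^sup>2))"
    using integrable_inverse_1_plus_square by (simp add: set_integrable_def inverse_eq_divide)
  have "integrable (lborel \<Otimes>\<^sub>M lborel)
      (\<lambda>x :: real \<times> real. (1 / (1 + (fst x)\<^sup>2)) * (1 / (1 + (snd x)\<^sup>2)))"
  proof (rule lborel_pair.Fubini_integrable)
    have "integrable lborel (\<lambda>x::real. 1 / (1 + x\<^sup>2) * (\<integral>y. 1 / (1 + y\<^sup>2) \<partial>lborel))"
      using one by (intro integrable_mult_left) auto
    moreover have "(\<integral>y. norm (1 / (1 + (fst (x, y))\<^sup>2) * (1 / (1 + (snd (x, y :: real))\<^sup>2))) \<partial>lborel)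
        = 1 / (1 + x\<^sup>2) * (\<integral>y. 1 / (1 + y\<^sup>2) \<partial>lborel)" for x :: real
      by (subst integral_mult_right_zero[symmetric]) (simp add: abs_mult)
    ultimately show "integrable lborel (\<lambda>x::real. \<integral>y. norm (1 / (1 + (fst (x, y))\<^sup>2) *
        (1 / (1 + (snd (x, y :: real))\<^sup>2))) \<partial>lborel)"
      by presburger
    show "AE x :: real in lborel. integrable lborel
        (\<lambda>y::real. 1 / (1 + (fst (x, y))\<^sup>2) * (1 / (1 + (snd (x, y))\<^sup>2)))"
    proof (rule AE_I2)
      fix x :: real
      show "integrable lborel (\<lambda>y::real. 1 / (1 + (fst (x, y))\<^sup>2) * (1 / (1 + (snd (x, y))\<^sup>2)))"
        using integrable_mult_right[OF one, of "1 / (1 + x\<^sup>2)"] by simp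
    qed
  qed auto
  then have two: "integrable lborel
      (\<lambda>x :: real \<times> real. (1 / (1 + (fst x)\<^sup>2)) * (1 / (1 + (snd x)\<^sup>2)))"
    by (simp add: lborel_prod)
  show ?thesis
  proof (rule Bochner_Integration.integrable_bound[OF two])
    show "AE x :: real \<times> real in lborel. norm (1 / (1 + norm x) ^ 4)
        \<le> norm (1 / (1 + (fst x)\<^sup>2) * (1 / (1 + (snd x)\<^sup>2)))"
    proof (rule AE_I2)
      fix x :: "real \<times> real"
      have n2: "(norm x)\<^sup>2 = (fst x)\<^sup>2 + (snd x)\<^sup>2"
        by (cases x) (simp add: norm_Pair)
      have sq: "1 + (norm x)\<^sup>2 \<le> (1 + norm x)\<^sup>2"
        by (simp add: power2_eq_square algebra_simps)
      have "(1 + (fst x)\<^sup>2) * (1 + (snd x)\<^sup>2) \<le> (1 + (norm x)\<^sup>2) * (1 + (norm x)\<^sup>2)"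
        unfolding n2 by (intro mult_mono) auto
      also have "\<dots> \<le> (1 + norm x)\<^sup>2 * (1 + norm x)\<^sup>2"
        using sq by (intro mult_mono) auto
      also have "\<dots> = (1 + norm x) ^ 4"
        by (simp add: power2_eq_square power4_eq_xxxx mult_ac)
      finally have le: "(1 + (fst x)\<^sup>2) * (1 + (snd x)\<^sup>2) \<le> (1 + norm x) ^ 4" .
      have pos: "0 < (1 + (fst x)\<^sup>2) * (1 + (snd x)\<^sup>2)"
        by (intro mult_pos_pos) (auto intro: add_pos_nonneg)
      have "1 / (1 + norm x) ^ 4 \<le> 1 / ((1 + (fst x)\<^sup>2) * (1 + (snd x)\<^sup>2))"
        by (rule divide_left_mono[OF le]) (use mult_pos_pos[OF less_le_trans[OF pos le] pos] in auto)
      then show "norm (1 / (1 + norm x) ^ 4)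
          \<le> norm (1 / (1 + (fst x)\<^sup>2) * (1 / (1 + (snd x)\<^sup>2)))"
        using pos by (simp add: abs_mult)
    qed
  qed simp
qed

lemma rapid_integrable:
  assumes "rapid K f" and "k \<in> K"
  shows "integrable lborel (f k)"
proof -
  obtain C where C: "C \<ge> 0" "\<And>k x. k \<in> K \<Longrightarrow> \<bar>f k x\<bar> \<le> C / (1 + norm x) ^ 4"
    using rapid_bound[OF assms(1), of 4] by metis
  have "integrable lborel (\<lambda>x :: real \<times> real. C * (1 / (1 + norm x) ^ 4))"
    by (intro integrable_mult_right integrable_plane_weight)
  moreover have "f k \<in> borel_measurable lborel"
    using rapid_continuous[OF assms] borel_measurable_continuous_onI by simp
  ultimately show ?thesis
    by (rule Bochner_Integration.integrable_bound)
       (use C assms(2) in \<open>auto intro!: AE_I2 order_trans[OF C(2)]\<close>)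
qed

section \<open>Integrals over the meridional half-plane\<close>

lemma half_plane_borel [measurable]: "half_plane \<in> sets borel"
proof -
  have "half_plane = {x :: real \<times> real. 0 < fst x}"
    by (auto simp: half_plane_def)
  moreover have "open {x :: real \<times> real. 0 < fst x}"
    by (intro open_Collect_less continuous_intros)
  ultimately show ?thesis
    by (metis borel_open)
qed

lemma mem_half_plane [simp]: "(r, z) \<in> half_plane \<longleftrightarrow> r > 0"
  by (simp add: half_plane_def)

text \<open>A gradient expressed by \<open>deriv\<close> is computable only almost everywhere and is not known to be
  Borel measurable. Over \<open>lebesgue\<close> it may be replaced by a Borel function equal to it off a
  negligible set.\<close>

lemma hp_AE_eq:
  fixes f :: "real \<times> real \<Rightarrow> real"
  assumes int: "integrable lborel (\<lambda>x. indicator half_plane x * f x)"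
    and eq: "AE x in lebesgue. x \<in> half_plane \<longrightarrow> (case x of (r, z) \<Rightarrow> g r z) = f x"
  shows hp_integrable_AE_eq: "hp_integrable g"
    and hp_integral_AE_eq: "hp_integral g = (\<integral>x. indicator half_plane x * f x \<partial>lborel)"
proof -
  let ?N = "{x. \<not> (x \<in> half_plane \<longrightarrow> (case x of (r, z) \<Rightarrow> g r z) = f x)}"
  have N: "negligible ?N"
    using eq by (simp add: eventually_ae_filter_negligible) (metis (lifting) negligible_subset)
  have meas: "(\<lambda>x. indicator half_plane x * f x) \<in> borel_measurable lborel"
    using int by simp
  have "integrable lebesgue (\<lambda>x. indicator half_plane x * f x)"
    using int meas integrable_completion by blast
  then have f: "set_integrable lebesgue half_plane f"
    by (simp add: set_integrable_def)
  have g: "set_integrable lebesgue half_plane (\<lambda>(r, z). g r z)"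
    by (rule absolutely_integrable_spike[OF f N]) auto
  then show "hp_integrable g"
    by (simp add: hp_integrable_def)
  have "hp_integral g = integral half_plane (\<lambda>(r, z). g r z)"
    using set_lebesgue_integral_eq_integral(2)[OF g] by (simp add: hp_integral_def)
  also have "\<dots> = integral half_plane f"
    by (rule integral_spike[OF N]) auto
  also have "\<dots> = (LINT x:half_plane|lebesgue. f x)"
    using set_lebesgue_integral_eq_integral(2)[OF f] by simp
  also have "\<dots> = (\<integral>x. indicator half_plane x * f x \<partial>lborel)"
    using integral_completion[OF meas] by (simp add: set_lebesgue_integral_def)
  finally show "hp_integral g = (\<integral>x. indicator half_plane x * f x \<partial>lborel)" .
qed

text \<open>Taken over \<open>lborel\<close>, a product measure, so that Fubini's theorem applies; the value agrees
  with \<open>hp_integral\<close> by the preceding lemma.\<close>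

definition hp_lint :: "(real \<times> real \<Rightarrow> real) \<Rightarrow> real" where
  "hp_lint f = (\<integral>x. indicator half_plane x * f x \<partial>lborel)"

lemma integrable_half_plane:
  "integrable lborel f \<Longrightarrow> integrable lborel (\<lambda>x. indicator half_plane x * f x :: real)"
  using integrable_mult_indicator[of half_plane lborel f] by simp

lemma hp_lint_cong: "(\<And>r z. r > 0 \<Longrightarrow> f (r, z) = g (r, z)) \<Longrightarrow> hp_lint f = hp_lint g"
  unfolding hp_lint_def
  by (rule Bochner_Integration.integral_cong) (auto simp: indicator_def half_plane_def)

lemma hp_lint_cmult: "hp_lint (\<lambda>x. c * f x) = c * hp_lint f"
  unfolding hp_lint_def by (simp add: mult.left_commute[of _ c])

lemma rapid_integrable_half_plane:
  "rapid K f \<Longrightarrow> k \<in> K \<Longrightarrow> integrable lborel (\<lambda>x. indicator half_plane x * f k x)"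
  by (intro integrable_half_plane rapid_integrable)

lemma hp_lint_add: "rapid1 f \<Longrightarrow> rapid1 g \<Longrightarrow> hp_lint (\<lambda>x. f x + g x) = hp_lint f + hp_lint g"
  unfolding hp_lint_def using rapid_integrable_half_plane[of "{()}" "\<lambda>_. f" "()"]
    rapid_integrable_half_plane[of "{()}" "\<lambda>_. g" "()"]
  by (simp add: distrib_left)

text \<open>By Fubini this is the fundamental theorem of calculus on each ray \<open>r > 0\<close>: the boundary
  term at infinity vanishes by decay, the one on the axis by assumption.\<close>

lemma hp_lint_radial_derivative:
  assumes f': "rapid1 f'" and f: "rapid1 f"
    and deriv: "\<And>r z. ((\<lambda>r. f (r, z)) has_real_derivative f' (r, z)) (at r)"
    and axis: "\<And>z. f (0, z) = 0"
  shows "hp_lint f' = 0"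
proof -
  have int: "integrable (lborel \<Otimes>\<^sub>M lborel) (\<lambda>(r, z). indicator half_plane (r, z) * f' (r, z))"
    using rapid_integrable_half_plane[OF f'] by (simp add: lborel_prod case_prod_unfold)
  have "hp_lint f' = (\<integral>x. (case x of (r, z) \<Rightarrow> indicator half_plane (r, z) * f' (r, z)) \<partial>(lborel \<Otimes>\<^sub>M lborel))"
    by (simp add: hp_lint_def lborel_prod)
  also have "\<dots> = (\<integral>z. (\<integral>r. indicator half_plane (r, z) * f' (r, z) \<partial>lborel) \<partial>lborel)"
    using lborel_pair.integral_snd[OF int] by (simp add: case_prod_unfold)
  also have "\<dots> = 0"
  proof (rule integral_eq_zero_AE)
    show "AE z in lborel. (\<integral>r. indicator half_plane (r, z) * f' (r, z) \<partial>lborel) = 0"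
      using lborel_pair.AE_integrable_snd[OF int]
    proof eventually_elim
      fix z :: real
      assume i: "integrable lborel (\<lambda>r. indicator half_plane (r, z) * f' (r, z))"
      have ind: "indicator half_plane (r, z) = (indicator (einterval 0 \<infinity>) r :: real)" for r
        by (auto simp: indicator_def einterval_def)
      have cont: "isCont (\<lambda>r. f' (r, z)) r" for r
      proof -
        have "continuous_on UNIV (\<lambda>r. f' (r, z))"
          by (rule continuous_on_compose2[OF rapid_continuous[OF f']])
             (auto intro!: continuous_intros)
        then show ?thesis
          by (simp add: continuous_on_eq_continuous_at)
      qed
      obtain C where C: "\<And>x. \<bar>f x\<bar> \<le> C / (1 + norm x) ^ 1"
        by (rule rapid1_bound[OF f, of 1], rule that)
      have "(LBINT r=0..\<infinity>. f' (r, z)) = 0 - f (0, z)"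
      proof (rule interval_integral_FTC_integrable[where F = "\<lambda>r. f (r, z)"])
        show "set_integrable lborel (einterval 0 \<infinity>) (\<lambda>r. f' (r, z))"
          using i by (simp add: set_integrable_def ind)
        have "((\<lambda>r. f (r, z)) \<longlongrightarrow> f (0, z)) (at 0)"
          using DERIV_isCont[OF deriv] by (simp add: isCont_def)
        then show "(((\<lambda>r. f (r, z)) \<circ> real_of_ereal) \<longlongrightarrow> f (0, z)) (at_right 0)"
          by (simp add: zero_ereal_def ereal_tendsto_simps filterlim_at_split)
        have "((\<lambda>r. f (r, z)) \<longlongrightarrow> 0) at_top"
        proof (rule Lim_null_comparison)
          show "\<forall>\<^sub>F r in at_top. norm (f (r, z)) \<le> C / (1 + norm (r, z)) ^ 1"
            using C by simp
          have "filterlim (\<lambda>r::real. 1 + norm (r, z)) at_top at_top"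
          proof (rule filterlim_at_top_mono)
            show "filterlim (\<lambda>r::real. r) at_top at_top"
              by (rule filterlim_ident)
            have "r \<le> 1 + norm (r, z)" for r :: real
              using norm_fst_le[of r z] by simp
            then show "\<forall>\<^sub>F r :: real in at_top. r \<le> 1 + norm (r, z)"
              by (rule always_eventually[OF allI])
          qed
          then show "((\<lambda>r::real. C / (1 + norm (r, z)) ^ 1) \<longlongrightarrow> 0) at_top"
            by (auto intro!: tendsto_divide_0[OF tendsto_const] filterlim_at_top_imp_at_infinity)
        qed
        then show "(((\<lambda>r. f (r, z)) \<circ> real_of_ereal) \<longlongrightarrow> 0) (at_left \<infinity>)"
          by (simp add: ereal_tendsto_simps)
      qed (use deriv cont in \<open>auto simp: has_real_derivative_iff_has_vector_derivative\<close>)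
      then show "(\<integral>r. indicator half_plane (r, z) * f' (r, z) \<partial>lborel) = 0"
        by (simp add: axis ind interval_lebesgue_integral_def set_lebesgue_integral_def)
    qed
  qed
  finally show ?thesis .
qed

text \<open>The same on each full line in the axial direction, where decay removes both boundary terms.\<close>

lemma hp_lint_axial_derivative:
  assumes f': "rapid1 f'" and f: "rapid1 f"
    and deriv: "\<And>r z. ((\<lambda>z. f (r, z)) has_real_derivative f' (r, z)) (at z)"
  shows "hp_lint f' = 0"
proof -
  have int: "integrable (lborel \<Otimes>\<^sub>M lborel) (\<lambda>(r, z). indicator half_plane (r, z) * f' (r, z))"
    using rapid_integrable_half_plane[OF f'] by (simp add: lborel_prod case_prod_unfold)
  have int': "integrable (lborel \<Otimes>\<^sub>M lborel) f'"
    using rapid_integrable[OF f'] by (simp add: lborel_prod)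
  have "hp_lint f' = (\<integral>x. (case x of (r, z) \<Rightarrow> indicator half_plane (r, z) * f' (r, z)) \<partial>(lborel \<Otimes>\<^sub>M lborel))"
    by (simp add: hp_lint_def lborel_prod)
  also have "\<dots> = (\<integral>r. (\<integral>z. indicator half_plane (r, z) * f' (r, z) \<partial>lborel) \<partial>lborel)"
    using lborel_pair.integral_fst'[OF int] by (simp add: case_prod_unfold)
  also have "\<dots> = 0"
  proof (rule integral_eq_zero_AE)
    show "AE r in lborel. (\<integral>z. indicator half_plane (r, z) * f' (r, z) \<partial>lborel) = 0"
      using lborel_pair.AE_integrable_fst'[OF int']
    proof eventually_elim
      fix r :: real
      assume i: "integrable lborel (\<lambda>z. f' (r, z))"
      have cont: "isCont (\<lambda>z. f' (r, z)) z" for z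
      proof -
        have "continuous_on UNIV (\<lambda>z. f' (r, z))"
          by (rule continuous_on_compose2[OF rapid_continuous[OF f']])
             (auto intro!: continuous_intros)
        then show ?thesis
          by (simp add: continuous_on_eq_continuous_at)
      qed
      obtain C where C: "\<And>x. \<bar>f x\<bar> \<le> C / (1 + norm x) ^ 1"
        by (rule rapid1_bound[OF f, of 1], rule that)
      have lim: "((\<lambda>z. f (r, z)) \<longlongrightarrow> 0) F" if F: "filterlim (\<lambda>z. \<bar>z\<bar>) at_top F" for F
      proof (rule Lim_null_comparison)
        show "\<forall>\<^sub>F z in F. norm (f (r, z)) \<le> C / (1 + norm (r, z)) ^ 1"
          using C by simp
        have "filterlim (\<lambda>z. 1 + norm (r, z)) at_top F"
          by (rule filterlim_at_top_mono[OF F])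
             (auto intro!: always_eventually add_increasing norm_snd_le[of "_::real", simplified])
        then show "((\<lambda>z. C / (1 + norm (r, z)) ^ 1) \<longlongrightarrow> 0) F"
          by (auto intro!: tendsto_divide_0[OF tendsto_const] filterlim_at_top_imp_at_infinity)
      qed
      have abs_bot: "filterlim (\<lambda>z::real. \<bar>z\<bar>) at_top at_bot"
        by (subst at_bot_mirror) (simp add: filterlim_filtermap filterlim_abs_real)
      have "(LBINT z=-\<infinity>..\<infinity>. f' (r, z)) = 0 - 0"
      proof (rule interval_integral_FTC_integrable[where F = "\<lambda>z. f (r, z)"])
        show "set_integrable lborel (einterval (-\<infinity>) \<infinity>) (\<lambda>z. f' (r, z))"
          using i by (simp add: set_integrable_def)
        show "(((\<lambda>z. f (r, z)) \<circ> real_of_ereal) \<longlongrightarrow> 0) (at_right (-\<infinity>))"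
          using lim[OF abs_bot] by (simp add: ereal_tendsto_simps)
        show "(((\<lambda>z. f (r, z)) \<circ> real_of_ereal) \<longlongrightarrow> 0) (at_left \<infinity>)"
          using lim[OF filterlim_abs_real] by (simp add: ereal_tendsto_simps)
      qed (use deriv cont in \<open>auto simp: has_real_derivative_iff_has_vector_derivative\<close>)
      then have z: "(\<integral>z. f' (r, z) \<partial>lborel) = 0"
        by (simp add: interval_lebesgue_integral_def set_lebesgue_integral_def)
      have "(\<lambda>z. indicator half_plane (r, z) * f' (r, z)) = (\<lambda>z. of_bool (r > 0) * f' (r, z))"
        by (auto simp: indicator_def)
      then show "(\<integral>z. indicator half_plane (r, z) * f' (r, z) \<partial>lborel) = 0"
        using z by simp
    qed
  qed
  finally show ?thesis .
qed

section \<open>The critical zero set\<close>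

text \<open>A zero with non-vanishing derivative is isolated among the zeros. A countable basis contains
  for each such zero a set that separates it from the others, and these sets are distinct.\<close>

lemma countable_simple_zeros:
  fixes h h' :: "real \<Rightarrow> real"
  assumes "\<And>x. (h has_real_derivative h' x) (at x)"
  shows "countable {x. h x = 0 \<and> h' x \<noteq> 0}"
proof -
  define S where "S = {x. h x = 0 \<and> h' x \<noteq> 0}"
  obtain \<B> :: "real set set" where \<B>: "countable \<B>" "topological_basis \<B>"
    using ex_countable_basis by blast
  have "\<exists>U\<in>\<B>. S \<inter> U = {x}" if x: "x \<in> S" for x
  proof -
    have "((\<lambda>y. (h y - h x) / (y - x)) \<longlongrightarrow> h' x) (at x)"
      using assms[of x] by (simp add: has_field_derivative_iff)
    then have "\<forall>\<^sub>F y in at x. (h y - h x) / (y - x) \<noteq> 0"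
      using x unfolding S_def using tendsto_imp_eventually_ne by blast
    then obtain V where V: "open V" "x \<in> V" "\<And>y. y \<in> V \<Longrightarrow> y \<noteq> x \<Longrightarrow> h y \<noteq> 0"
      using x unfolding S_def eventually_at_topological by fastforce
    obtain U where "U \<in> \<B>" "x \<in> U" "U \<subseteq> V"
      using topological_basisE[OF \<B>(2) V(1,2)] by blast
    then show ?thesis
      using V(3) x unfolding S_def by blast
  qed
  then have "\<forall>x\<in>S. \<exists>U. U \<in> \<B> \<and> S \<inter> U = {x}"
    by blast
  then obtain U where "\<forall>x\<in>S. U x \<in> \<B> \<and> S \<inter> U x = {x}"
    unfolding bchoice_iff by blast
  then have U: "U x \<in> \<B> \<and> S \<inter> U x = {x}" if "x \<in> S" for x
    using that by (rule bspec)
  have "x = y" if "x \<in> S" "y \<in> S" "U x = U y" for x y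
  proof -
    have "{x} = S \<inter> U x"
      using conjunct2[OF U[OF that(1)]] by (rule sym)
    also have "\<dots> = S \<inter> U y"
      by (simp only: that(3))
    also have "\<dots> = {y}"
      using U[OF that(2)] by (rule conjunct2)
    finally show ?thesis
      by (rule singleton_inject)
  qed
  then have "inj_on U S"
    by (rule inj_onI)
  moreover have "countable (U ` S)"
    using U \<B>(1) by (auto intro: countable_subset)
  ultimately show ?thesis
    unfolding S_def using countable_image_inj_on by blast
qed

text \<open>On every line the zeros at which the derivative along the line does not vanish are
  isolated, hence countable. By Fubini the gradient vanishes almost everywhere on the zero set.\<close>

lemma AE_critical_zeros:
  fixes g gr gz :: "real \<times> real \<Rightarrow> real"
  assumes cont: "continuous_on UNIV g" "continuous_on UNIV gr" "continuous_on UNIV gz"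
    and dr: "\<And>r z. ((\<lambda>r. g (r, z)) has_real_derivative gr (r, z)) (at r)"
    and dz: "\<And>r z. ((\<lambda>z. g (r, z)) has_real_derivative gz (r, z)) (at z)"
  shows "AE x in lborel. g x = 0 \<longrightarrow> gr x = 0 \<and> gz x = 0"
proof -
  have m [measurable]: "g \<in> borel_measurable borel" "gr \<in> borel_measurable borel"
    "gz \<in> borel_measurable borel"
    using cont by (auto intro: borel_measurable_continuous_onI)
  have null: "AE x in lborel. \<not> (h x = 0 \<and> h' x \<noteq> 0)"
    if "\<And>x. (h has_real_derivative h' x) (at x)" for h h' :: "real \<Rightarrow> real"
    using AE_not_in[OF countable_imp_null_set_lborel[OF countable_simple_zeros[OF that]]] by auto
  have meas: "{x \<in> space (lborel \<Otimes>\<^sub>M lborel). \<not> (g x = 0 \<and> d x \<noteq> 0)}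
      \<in> sets (lborel \<Otimes>\<^sub>M lborel)"
    if [measurable]: "d \<in> borel_measurable borel" for d :: "real \<times> real \<Rightarrow> real"
    unfolding lborel_prod by measurable
  have "AE x in lborel \<Otimes>\<^sub>M lborel. \<not> (g x = 0 \<and> gz x \<noteq> 0)"
    by (rule lborel_pair.AE_pair_measure[OF meas]) (use null[OF dz] in auto)
  moreover have "AE r in lborel. AE z in lborel. \<not> (g (r, z) = 0 \<and> gr (r, z) \<noteq> 0)"
    using lborel_pair.AE_commute[of "\<lambda>r z. \<not> (g (r, z) = 0 \<and> gr (r, z) \<noteq> 0)"]
      meas[OF m(2)] null[OF dr] by simp
  then have "AE x in lborel \<Otimes>\<^sub>M lborel. \<not> (g x = 0 \<and> gr x \<noteq> 0)"
    by (intro lborel_pair.AE_pair_measure[OF meas]) auto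
  ultimately show ?thesis
    unfolding lborel_prod by (auto elim: eventually_elim2)
qed

section \<open>Signed powers and their regularisation\<close>

definition signed_power :: "real \<Rightarrow> real \<Rightarrow> real" where
  "signed_power q s = sgn s * \<bar>s\<bar> powr q"

lemma abs_signed_power [simp]: "\<bar>signed_power q s\<bar> = \<bar>s\<bar> powr q"
  by (simp add: signed_power_def abs_mult abs_sgn_eq)

lemma continuous_abs_powr: "q > 0 \<Longrightarrow> continuous_on UNIV (\<lambda>s::real. \<bar>s\<bar> powr q)"
  by (intro continuous_on_powr' continuous_intros) auto

lemma continuous_signed_power: "q > 0 \<Longrightarrow> continuous_on UNIV (signed_power q)"
proof -
  assume q: "q > 0"
  have "signed_power q = (\<lambda>s. max s 0 powr q - max (- s) 0 powr q)"
    using q by (auto simp: signed_power_def sgn_if max_def fun_eq_iff)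
  moreover have "continuous_on UNIV (\<lambda>s::real. max s 0 powr q - max (- s) 0 powr q)"
    using q by (intro continuous_on_diff continuous_on_powr' continuous_intros) auto
  ultimately show ?thesis
    by simp
qed

text \<open>A bound of order \<open>p > 1\<close> makes the difference quotient tend to zero. The lemma serves at
  the zeros of a power, where the chain rule is not available.\<close>

lemma has_derivative_zero_if_powr_bound:
  fixes f :: "'a::real_normed_vector \<Rightarrow> 'b::real_normed_vector"
  assumes p: "p > 1"
    and bound: "\<forall>\<^sub>F y in at x. norm (f y - f x) \<le> C * norm (y - x) powr p"
  shows "(f has_derivative (\<lambda>_. 0)) (at x)"
  unfolding has_derivative_iff_norm
proof
  show "((\<lambda>y. norm (f y - f x - 0) / norm (y - x)) \<longlongrightarrow> 0) (at x)"
  proof (rule Lim_null_comparison)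
    show "\<forall>\<^sub>F y in at x. norm (norm (f y - f x - 0) / norm (y - x))
        \<le> C * norm (y - x) powr (p - 1)"
      using bound eventually_neq_at_within[of x x]
    proof eventually_elim
      case (elim y)
      then have n: "norm (y - x) > 0"
        by simp
      have "norm (y - x) powr p = norm (y - x) powr (p - 1) * norm (y - x)"
        using n by (simp add: powr_diff)
      then show ?case
        using elim n by (simp add: divide_le_eq mult.assoc)
    qed
    have "((\<lambda>y. norm (y - x) powr (p - 1)) \<longlongrightarrow> 0) (at x)"
      using p by (intro tendsto_zero_powrI[of _ _ _ "p - 1"]) (auto intro!: tendsto_eq_intros)
    then show "((\<lambda>y. C * norm (y - x) powr (p - 1)) \<longlongrightarrow> 0) (at x)"
      by (rule tendsto_mult_right_zero)
  qed
qed (rule bounded_linear_zero)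

lemma has_real_derivative_zero_if_powr_bound:
  fixes f :: "real \<Rightarrow> real"
  assumes "p > 1" and "\<And>y. \<bar>f y\<bar> \<le> C * \<bar>y\<bar> powr p"
  shows "(f has_real_derivative 0) (at 0)"
proof -
  have "f 0 = 0"
    using assms(2)[of 0] by simp
  then have "(f has_derivative (\<lambda>_. 0)) (at 0)"
    using assms by (intro has_derivative_zero_if_powr_bound[where p = p and C = C]) auto
  then show ?thesis
    by (simp add: has_field_derivative_def lambda_zero)
qed

lemma abs_has_derivative_sgn:
  fixes s :: real
  assumes "s \<noteq> 0"
  shows "(abs has_real_derivative sgn s) (at s)"
proof (rule has_field_derivative_transform_within_open)
  show "((\<lambda>x. sgn s * x) has_real_derivative sgn s) (at s)"
    by (auto intro!: derivative_eq_intros)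
  show "open (if s > 0 then {0<..} else {..<0::real})" "s \<in> (if s > 0 then {0<..} else {..<0})"
    using assms by auto
  show "sgn s * x = \<bar>x\<bar>" if "x \<in> (if s > 0 then {0<..} else {..<0})" for x
    using assms that by (auto split: if_splits)
qed

lemma abs_powr_has_derivative_nonzero:
  fixes s :: real
  assumes "s \<noteq> 0"
  shows "((\<lambda>s. \<bar>s\<bar> powr q) has_real_derivative q * signed_power (q - 1) s) (at s)"
proof -
  have "((\<lambda>s. \<bar>s\<bar> powr q) has_real_derivative q * \<bar>s\<bar> powr (q - 1) * sgn s) (at s)"
    using assms by (auto intro!: derivative_eq_intros abs_has_derivative_sgn simp: powr_diff)
  then show ?thesis
    by (simp add: signed_power_def mult_ac)
qed

lemma abs_powr_has_derivative:
  assumes "p > 1"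
  shows "((\<lambda>s. \<bar>s\<bar> powr p) has_real_derivative p * signed_power (p - 1) s) (at s)"
proof (cases "s = 0")
  case True
  then show ?thesis
    using has_real_derivative_zero_if_powr_bound[OF assms, of "\<lambda>s. \<bar>s\<bar> powr p" 1]
    by (simp add: signed_power_def)
qed (rule abs_powr_has_derivative_nonzero)

text \<open>For \<open>p < 2\<close> the signed power of exponent \<open>p - 1\<close> is not differentiable at zero. The
  damping factor \<open>|s| / (|s| + \<epsilon>)\<close> raises its order of vanishing to \<open>p\<close>, which makes it \<open>C\<^sup>1\<close>
  with derivative \<open>0\<close> there. The derivative \<open>reg_power'\<close> is non-negative, lies below a multiple of
  the limit \<open>(p - 1) |s|\<^sup>p\<^sup>-\<^sup>2\<close>, and converges to it; at \<open>s = 0\<close> both sides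
  vanish, since \<open>0 powr q = 0\<close>.\<close>

definition reg_power :: "real \<Rightarrow> real \<Rightarrow> real \<Rightarrow> real" where
  "reg_power \<epsilon> p s = signed_power (p - 1) s * (\<bar>s\<bar> / (\<bar>s\<bar> + \<epsilon>))"

definition reg_power' :: "real \<Rightarrow> real \<Rightarrow> real \<Rightarrow> real" where
  "reg_power' \<epsilon> p s = \<bar>s\<bar> powr (p - 1) * (((p - 1) * \<bar>s\<bar> + p * \<epsilon>) / (\<bar>s\<bar> + \<epsilon>)\<^sup>2)"

lemma continuous_reg_power:
  assumes "\<epsilon> > 0" "p > 1"
  shows "continuous_on UNIV (reg_power \<epsilon> p)"
proof -
  have "continuous_on UNIV (\<lambda>s. signed_power (p - 1) s * (\<bar>s\<bar> / (\<bar>s\<bar> + \<epsilon>)))"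
    using assms by (intro continuous_intros continuous_signed_power) (auto simp: add_nonneg_eq_0_iff)
  then show ?thesis
    by (simp add: reg_power_def[abs_def])
qed

lemma continuous_reg_power':
  assumes "\<epsilon> > 0" "p > 1"
  shows "continuous_on UNIV (reg_power' \<epsilon> p)"
proof -
  have "continuous_on UNIV (\<lambda>s. \<bar>s\<bar> powr (p - 1) * (((p - 1) * \<bar>s\<bar> + p * \<epsilon>) / (\<bar>s\<bar> + \<epsilon>)\<^sup>2))"
    using assms by (intro continuous_on_mult continuous_on_divide continuous_abs_powr continuous_intros)
      (auto simp: add_nonneg_eq_0_iff)
  then show ?thesis
    by (simp add: reg_power'_def[abs_def])
qed

lemma reg_power_has_derivative:
  assumes "\<epsilon> > 0" "p > 1"
  shows "(reg_power \<epsilon> p has_real_derivative reg_power' \<epsilon> p s) (at s)"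
proof (cases "s = 0")
  case True
  have "\<bar>reg_power \<epsilon> p y\<bar> \<le> 1 / \<epsilon> * \<bar>y\<bar> powr p" for y
  proof -
    have "\<bar>y\<bar> powr p = \<bar>y\<bar> powr (p - 1) * \<bar>y\<bar>"
      by (cases "y = 0") (simp_all add: powr_diff)
    then have "\<bar>reg_power \<epsilon> p y\<bar> = \<bar>y\<bar> powr p / (\<bar>y\<bar> + \<epsilon>)"
      using assms by (simp add: reg_power_def abs_mult)
    also have "\<dots> \<le> \<bar>y\<bar> powr p / \<epsilon>"
      using assms by (intro divide_left_mono) (auto intro!: mult_pos_pos add_nonneg_pos)
    finally show ?thesis
      by simp
  qed
  from has_real_derivative_zero_if_powr_bound[OF assms(2) this] show ?thesis
    using True by (simp add: reg_power'_def)
next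
  case False
  have eq: "sgn s * (\<bar>s\<bar> powr p / (\<bar>s\<bar> + \<epsilon>)) = reg_power \<epsilon> p s" for s
    using assms by (cases "s = 0") (auto simp: reg_power_def signed_power_def powr_diff)
  have "((\<lambda>y. sgn s * (\<bar>y\<bar> powr p / (\<bar>y\<bar> + \<epsilon>))) has_real_derivative
      sgn s * ((p * signed_power (p - 1) s * (\<bar>s\<bar> + \<epsilon>) - \<bar>s\<bar> powr p * sgn s) / (\<bar>s\<bar> + \<epsilon>)\<^sup>2)) (at s)"
    using False assms
    by (auto intro!: derivative_eq_intros abs_powr_has_derivative_nonzero
        abs_has_derivative_sgn
        simp: power2_eq_square add_nonneg_eq_0_iff signed_power_def algebra_simps)
  moreover have "sgn s * ((p * signed_power (p - 1) s * (\<bar>s\<bar> + \<epsilon>) - \<bar>s\<bar> powr p * sgn s) / (\<bar>s\<bar> + \<epsilon>)\<^sup>2)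
      = reg_power' \<epsilon> p s"
  proof -
    have ss: "sgn s * sgn s = 1"
      using False by (simp add: sgn_if)
    have pp: "\<bar>s\<bar> powr p = \<bar>s\<bar> powr (p - 1) * \<bar>s\<bar>"
      using False by (simp add: powr_diff)
    have "sgn s * (p * signed_power (p - 1) s * (\<bar>s\<bar> + \<epsilon>) - \<bar>s\<bar> powr p * sgn s)
        = (sgn s * sgn s) * \<bar>s\<bar> powr (p - 1) * (p * (\<bar>s\<bar> + \<epsilon>) - \<bar>s\<bar>)"
      unfolding signed_power_def pp by (simp add: algebra_simps)
    also have "\<dots> = \<bar>s\<bar> powr (p - 1) * ((p - 1) * \<bar>s\<bar> + p * \<epsilon>)"
      unfolding ss by (simp add: algebra_simps)
    finally show ?thesis
      by (simp add: reg_power'_def)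
  qed
  ultimately have "((\<lambda>y. sgn s * (\<bar>y\<bar> powr p / (\<bar>y\<bar> + \<epsilon>))) has_real_derivative
      reg_power' \<epsilon> p s) (at s)"
    by simp
  moreover have "\<forall>\<^sub>F y in nhds s. sgn s * (\<bar>y\<bar> powr p / (\<bar>y\<bar> + \<epsilon>)) = reg_power \<epsilon> p y"
  proof -
    have "\<forall>\<^sub>F y in nhds s. y \<in> (if s > 0 then {0<..} else {..<0})"
      using False by (intro eventually_nhds_in_open) auto
    then show ?thesis
      by eventually_elim (use False in \<open>auto simp: eq[symmetric] sgn_if split: if_splits\<close>)
  qed
  ultimately show ?thesis
    using DERIV_cong_ev[OF refl _ refl, of "\<lambda>y. sgn s * (\<bar>y\<bar> powr p / (\<bar>y\<bar> + \<epsilon>))" "reg_power \<epsilon> p" s]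
    by simp
qed

lemma abs_reg_power_le: "\<epsilon> > 0 \<Longrightarrow> \<bar>reg_power \<epsilon> p s\<bar> \<le> \<bar>s\<bar> powr (p - 1)"
  unfolding reg_power_def abs_mult abs_signed_power
  by (rule mult_left_le) (auto simp: divide_le_eq_1)

lemma reg_power'_nonneg: "\<epsilon> > 0 \<Longrightarrow> p > 1 \<Longrightarrow> 0 \<le> reg_power' \<epsilon> p s"
  by (auto simp: reg_power'_def)

lemma reg_power'_le:
  assumes "\<epsilon> > 0" "p > 1"
  shows "reg_power' \<epsilon> p s \<le> p * \<bar>s\<bar> powr (p - 2)"
proof (cases "s = 0")
  case False
  have pp: "\<bar>s\<bar> powr (p - 1) = \<bar>s\<bar> powr (p - 2) * \<bar>s\<bar>"
    using False powr_add[of "\<bar>s\<bar>" "p - 2" 1] by simp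
  have "\<bar>s\<bar> * ((p - 1) * \<bar>s\<bar> + p * \<epsilon>) \<le> (\<bar>s\<bar> + \<epsilon>) * (p * (\<bar>s\<bar> + \<epsilon>))"
  proof (rule mult_mono)
    have "0 \<le> p * \<epsilon>" "0 \<le> \<bar>s\<bar>"
      using assms by simp_all
    then show "(p - 1) * \<bar>s\<bar> + p * \<epsilon> \<le> p * (\<bar>s\<bar> + \<epsilon>)"
      by (simp add: algebra_simps)
  qed (use assms in auto)
  then have "\<bar>s\<bar> * ((p - 1) * \<bar>s\<bar> + p * \<epsilon>) / (\<bar>s\<bar> + \<epsilon>)\<^sup>2 \<le> p"
    using assms by (simp add: divide_le_eq power2_eq_square mult_ac)
  then have "\<bar>s\<bar> powr (p - 2) * (\<bar>s\<bar> * ((p - 1) * \<bar>s\<bar> + p * \<epsilon>) / (\<bar>s\<bar> + \<epsilon>)\<^sup>2)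
      \<le> \<bar>s\<bar> powr (p - 2) * p"
    by (rule mult_left_mono) simp
  then show ?thesis
    by (simp add: reg_power'_def pp mult_ac)
qed (simp add: reg_power'_def)

lemma reg_power_tendsto:
  "(\<lambda>n. reg_power (1 / Suc n) p s) \<longlonglongrightarrow> signed_power (p - 1) s"
proof (cases "s = 0")
  case False
  have "(\<lambda>n. signed_power (p - 1) s * (\<bar>s\<bar> / (\<bar>s\<bar> + 1 / Suc n))) \<longlonglongrightarrow>
      signed_power (p - 1) s * (\<bar>s\<bar> / (\<bar>s\<bar> + 0))"
    using False LIMSEQ_inverse_real_of_nat
    by (intro tendsto_intros) (auto simp: inverse_eq_divide)
  then show ?thesis
    using False by (simp add: reg_power_def)
qed (simp add: reg_power_def signed_power_def)

lemma reg_power'_tendsto: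
  "(\<lambda>n. reg_power' (1 / Suc n) p s) \<longlonglongrightarrow> (p - 1) * \<bar>s\<bar> powr (p - 2)"
proof (cases "s = 0")
  case False
  have pp: "\<bar>s\<bar> powr (p - 1) = \<bar>s\<bar> powr (p - 2) * \<bar>s\<bar>"
    using False powr_add[of "\<bar>s\<bar>" "p - 2" 1] by simp
  have "(\<lambda>n. \<bar>s\<bar> powr (p - 1) * (((p - 1) * \<bar>s\<bar> + p * (1 / Suc n)) / (\<bar>s\<bar> + 1 / Suc n)\<^sup>2)) \<longlonglongrightarrow>
      \<bar>s\<bar> powr (p - 1) * (((p - 1) * \<bar>s\<bar> + p * 0) / (\<bar>s\<bar> + 0)\<^sup>2)"
    using False LIMSEQ_inverse_real_of_nat
    by (intro tendsto_intros) (auto simp: inverse_eq_divide)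
  moreover have "\<bar>s\<bar> powr (p - 1) * (((p - 1) * \<bar>s\<bar> + p * 0) / (\<bar>s\<bar> + 0)\<^sup>2) =
      (p - 1) * \<bar>s\<bar> powr (p - 2)"
    using False unfolding pp power2_eq_square by (simp del: abs_mult_self_eq)
  ultimately show ?thesis
    by (simp add: reg_power'_def)
qed (simp add: reg_power'_def)

section \<open>Green's identity for powers\<close>

text \<open>Fatou's lemma and the convergence of the integrals give the integrability of the limit \<open>f\<close>;
  the multiple \<open>B f\<close> is then an integrable majorant of the sequence, so that the integrals converge
  to the integral of \<open>f\<close>.\<close>

lemma integral_fatou_dominated:
  fixes h :: "nat \<Rightarrow> 'a \<Rightarrow> real" and f :: "'a \<Rightarrow> real"
  assumes int: "\<And>n. integrable M (h n)" and nonneg: "\<And>n x. 0 \<le> h n x"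
    and lim: "\<And>x. (\<lambda>n. h n x) \<longlonglongrightarrow> f x"
    and bound: "\<And>n x. h n x \<le> B * f x"
    and c: "(\<lambda>n. integral\<^sup>L M (h n)) \<longlonglongrightarrow> c"
  shows "integrable M f" "integral\<^sup>L M f = c"
proof -
  have meas [measurable]: "f \<in> borel_measurable M"
    by (rule borel_measurable_LIMSEQ_real[OF lim borel_measurable_integrable[OF int]])
  have f0: "0 \<le> f x" for x
    by (rule LIMSEQ_le_const[OF lim]) (use nonneg in blast)
  have "(\<integral>\<^sup>+x. ennreal (f x) \<partial>M) = (\<integral>\<^sup>+x. liminf (\<lambda>n. ennreal (h n x)) \<partial>M)"
    using lim_imp_Liminf[OF trivial_limit_sequentially tendsto_ennrealI[OF lim]]
    by (intro nn_integral_cong) simp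
  also have "\<dots> \<le> liminf (\<lambda>n. \<integral>\<^sup>+x. ennreal (h n x) \<partial>M)"
    using int by (intro nn_integral_liminf) auto
  also have "\<dots> = liminf (\<lambda>n. ennreal (integral\<^sup>L M (h n)))"
    using int nonneg by (simp add: nn_integral_eq_integral)
  also have "\<dots> = ennreal c"
    using c by (intro lim_imp_Liminf tendsto_ennrealI) auto
  finally have "(\<integral>\<^sup>+x. ennreal (f x) \<partial>M) < \<infinity>"
    by (rule order_le_less_trans) simp
  then show f: "integrable M f"
    using f0 by (intro integrableI_nonneg) auto
  have "(\<lambda>n. integral\<^sup>L M (h n)) \<longlonglongrightarrow> integral\<^sup>L M f"
  proof (rule integral_dominated_convergence[where w = "\<lambda>x. B * f x"])
    show "integrable M (\<lambda>x. B * f x)"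
      using f by simp
  qed (use int lim bound nonneg in auto)
  then show "integral\<^sup>L M f = c"
    using c LIMSEQ_unique by blast
qed

text \<open>A scalar function on the meridional plane with its two partial derivatives, here the
  circulation at one instant. It is given for all real \<open>r\<close>, so that derivatives on the axis are
  two-sided.\<close>

locale half_plane_profile =
  fixes g gr gz :: "real \<times> real \<Rightarrow> real"
  assumes rapid_g: "rapid1 g" and rapid_gr: "rapid1 gr" and rapid_gz: "rapid1 gz"
    and g_dr: "\<And>r z. ((\<lambda>r. g (r, z)) has_real_derivative gr (r, z)) (at r)"
    and g_dz: "\<And>r z. ((\<lambda>z. g (r, z)) has_real_derivative gz (r, z)) (at z)"
begin

lemma compose_dr:
  "(\<And>s. (\<psi> has_real_derivative \<psi>' s) (at s)) \<Longrightarrow>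
    ((\<lambda>r. \<psi> (g (r, z))) has_real_derivative \<psi>' (g (r, z)) * gr (r, z)) (at r)"
  using DERIV_chain2[OF _ g_dr] by blast

lemma compose_dz:
  "(\<And>s. (\<psi> has_real_derivative \<psi>' s) (at s)) \<Longrightarrow>
    ((\<lambda>z. \<psi> (g (r, z))) has_real_derivative \<psi>' (g (r, z)) * gz (r, z)) (at z)"
  using DERIV_chain2[OF _ g_dz] by blast

text \<open>The flux \<open>r \<psi>(g) \<nabla>g\<close> vanishes on the axis because of the factor \<open>r\<close>; its divergence is
  the sum of the two integrands, hence integrates to zero.\<close>

lemma regular_green:
  assumes grr: "rapid1 grr" "\<And>r z. ((\<lambda>r. gr (r, z)) has_real_derivative grr (r, z)) (at r)"
    and gzz: "rapid1 gzz" "\<And>r z. ((\<lambda>z. gz (r, z)) has_real_derivative gzz (r, z)) (at z)"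
    and \<psi>: "continuous_on UNIV \<psi>" and \<psi>': "continuous_on UNIV \<psi>'"
    and deriv: "\<And>s. (\<psi> has_real_derivative \<psi>' s) (at s)"
  shows "hp_lint (\<lambda>x. \<psi>' (g x) * (fst x * ((gr x)\<^sup>2 + (gz x)\<^sup>2))) =
    - hp_lint (\<lambda>x. \<psi> (g x) * (fst x * grr x + gr x + fst x * gzz x))"
proof -
  note rapid_intros = rapid_mult_compose[OF \<psi> rapid_g] rapid_mult_compose[OF \<psi>' rapid_g]
    rapid_add rapid_mult_fst rapid_mult rapid_g rapid_gr rapid_gz grr(1) gzz(1)
  \<comment> \<open>the radial and the axial part of the divergence of \<open>r \<psi>(g) \<nabla>g\<close>\<close>
  have 1: "hp_lint (\<lambda>x. \<psi>' (g x) * (fst x * (gr x * gr x)) + \<psi> (g x) * (fst x * grr x + gr x)) = 0"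
  proof (rule hp_lint_radial_derivative[where f = "\<lambda>x. \<psi> (g x) * (fst x * gr x)"])
    show "((\<lambda>r. \<psi> (g (r, z)) * (fst (r, z) * gr (r, z))) has_real_derivative
        \<psi>' (g (r, z)) * (fst (r, z) * (gr (r, z) * gr (r, z))) +
        \<psi> (g (r, z)) * (fst (r, z) * grr (r, z) + gr (r, z))) (at r)" for r z
      by (rule derivative_eq_intros compose_dr[OF deriv] grr(2) refl | simp add: algebra_simps)+
  qed (intro rapid_intros | simp)+
  have 2: "hp_lint (\<lambda>x. \<psi>' (g x) * (fst x * (gz x * gz x)) + \<psi> (g x) * (fst x * gzz x)) = 0"
  proof (rule hp_lint_axial_derivative[where f = "\<lambda>x. \<psi> (g x) * (fst x * gz x)"])
    show "((\<lambda>z. \<psi> (g (r, z)) * (fst (r, z) * gz (r, z))) has_real_derivative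
        \<psi>' (g (r, z)) * (fst (r, z) * (gz (r, z) * gz (r, z))) +
        \<psi> (g (r, z)) * (fst (r, z) * gzz (r, z))) (at z)" for r z
      by (rule derivative_eq_intros compose_dz[OF deriv] gzz(2) refl | simp add: algebra_simps)+
  qed (intro rapid_intros | simp)+
  have "0 = hp_lint (\<lambda>x. (\<psi>' (g x) * (fst x * (gr x * gr x)) + \<psi> (g x) * (fst x * grr x + gr x)) +
      (\<psi>' (g x) * (fst x * (gz x * gz x)) + \<psi> (g x) * (fst x * gzz x)))"
    using 1 2 by (subst hp_lint_add) (intro rapid_intros | simp)+
  also have "\<dots> = hp_lint (\<lambda>x. \<psi>' (g x) * (fst x * (gr x * gr x + gz x * gz x)) +
      \<psi> (g x) * (fst x * grr x + gr x + fst x * gzz x))"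
    by (rule arg_cong[of _ _ hp_lint]) (simp add: fun_eq_iff algebra_simps)
  also have "\<dots> = hp_lint (\<lambda>x. \<psi>' (g x) * (fst x * (gr x * gr x + gz x * gz x))) +
      hp_lint (\<lambda>x. \<psi> (g x) * (fst x * grr x + gr x + fst x * gzz x))"
    by (rule hp_lint_add) (intro rapid_intros)+
  finally show ?thesis
    by (simp add: power2_eq_square)
qed

text \<open>The previous identity applied to \<open>reg_power\<close>, in the limit \<open>\<epsilon> \<rightarrow> 0\<close>. The right-hand side
  converges by domination. Nothing is known in advance about the integrability of
  \<open>|g|\<^sup>p\<^sup>-\<^sup>2 |\<nabla>g|\<^sup>2\<close>, which for \<open>p < 2\<close> is singular at the zeros of \<open>g\<close>: it is part of the
  conclusion and comes from Fatou's lemma.\<close>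

lemma power_green:
  assumes grr: "rapid1 grr" "\<And>r z. ((\<lambda>r. gr (r, z)) has_real_derivative grr (r, z)) (at r)"
    and gzz: "rapid1 gzz" "\<And>r z. ((\<lambda>z. gz (r, z)) has_real_derivative gzz (r, z)) (at z)"
    and p: "p > 1"
  shows power_gradient_integrable: "integrable lborel
      (\<lambda>x. indicator half_plane x * (\<bar>g x\<bar> powr (p - 2) * (fst x * ((gr x)\<^sup>2 + (gz x)\<^sup>2))))" (is ?I)
    and power_green_identity:
      "(p - 1) * hp_lint (\<lambda>x. \<bar>g x\<bar> powr (p - 2) * (fst x * ((gr x)\<^sup>2 + (gz x)\<^sup>2))) =
        - hp_lint (\<lambda>x. signed_power (p - 1) (g x) * (fst x * grr x + gr x + fst x * gzz x))" (is ?E)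
proof -
  define Q where "Q = (\<lambda>x. fst x * ((gr x)\<^sup>2 + (gz x)\<^sup>2))"
  define L where "L = (\<lambda>x. fst x * grr x + gr x + fst x * gzz x)"
  define \<epsilon> where "\<epsilon> = (\<lambda>n. 1 / real (Suc n))"
  define h where "h = (\<lambda>n x. indicator half_plane x * (reg_power' (\<epsilon> n) p (g x) * Q x))"
  define f where "f = (\<lambda>x. (p - 1) * (indicator half_plane x * (\<bar>g x\<bar> powr (p - 2) * Q x)))"
  have \<epsilon>: "\<epsilon> n > 0" for n
    by (simp add: \<epsilon>_def)
  have Q: "rapid1 Q"
    unfolding Q_def power2_eq_square
    by (intro rapid_mult_fst rapid_add rapid_mult rapid_gr rapid_gz)
  have L: "rapid1 L"
    unfolding L_def by (intro rapid_mult_fst rapid_add rapid_gr grr gzz)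
  have Qpos: "0 \<le> indicator half_plane x * Q x" for x
    by (auto simp: Q_def half_plane_def indicator_def)
  have ih: "integrable lborel (h n)" for n
    unfolding h_def
    by (rule rapid_integrable_half_plane[of "{()}" "\<lambda>_ x. reg_power' (\<epsilon> n) p (g x) * Q x"])
       (rule rapid_mult_compose[OF continuous_reg_power'[OF \<epsilon> p] rapid_g Q], simp)
  have green: "integral\<^sup>L lborel (h n) =
      - (\<integral>x. indicator half_plane x * (reg_power (\<epsilon> n) p (g x) * L x) \<partial>lborel)" for n
    using regular_green[OF grr gzz continuous_reg_power[OF \<epsilon> p] continuous_reg_power'[OF \<epsilon> p]
        reg_power_has_derivative[OF \<epsilon> p], of n]
    by (simp add: h_def Q_def L_def hp_lint_def)
  have iL: "integrable lborel (\<lambda>x. indicator half_plane x * (signed_power (p - 1) (g x) * L x))"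
    by (rule rapid_integrable_half_plane[of "{()}" "\<lambda>_ x. signed_power (p - 1) (g x) * L x"])
       (rule rapid_mult_compose[OF continuous_signed_power rapid_g L], use p in simp_all)
  have "(\<lambda>n. \<integral>x. indicator half_plane x * (reg_power (\<epsilon> n) p (g x) * L x) \<partial>lborel) \<longlonglongrightarrow>
      (\<integral>x. indicator half_plane x * (signed_power (p - 1) (g x) * L x) \<partial>lborel)"
  proof (rule integral_dominated_convergence)
    show "integrable lborel (\<lambda>x. \<bar>indicator half_plane x * (signed_power (p - 1) (g x) * L x)\<bar>)"
      using iL by (rule integrable_abs)
    show "(\<lambda>x. indicator half_plane x * (reg_power (\<epsilon> n) p (g x) * L x)) \<in> borel_measurable lborel" for n
      by (rule borel_measurable_integrable,
          rule rapid_integrable_half_plane[of "{()}" "\<lambda>_ x. reg_power (\<epsilon> n) p (g x) * L x"])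
         (rule rapid_mult_compose[OF continuous_reg_power[OF \<epsilon> p] rapid_g L], simp)
    show "AE x in lborel. (\<lambda>n. indicator half_plane x * (reg_power (\<epsilon> n) p (g x) * L x)) \<longlonglongrightarrow>
        indicator half_plane x * (signed_power (p - 1) (g x) * L x)"
      unfolding \<epsilon>_def by (intro AE_I2 tendsto_intros reg_power_tendsto)
    show "AE x in lborel. norm (indicator half_plane x * (reg_power (\<epsilon> n) p (g x) * L x)) \<le>
        \<bar>indicator half_plane x * (signed_power (p - 1) (g x) * L x)\<bar>" for n
      using abs_reg_power_le[OF \<epsilon>] by (intro AE_I2) (auto simp: abs_mult intro!: mult_left_mono mult_right_mono)
  qed (use iL in auto)
  then have c: "(\<lambda>n. integral\<^sup>L lborel (h n)) \<longlonglongrightarrow> - hp_lint (\<lambda>x. signed_power (p - 1) (g x) * L x)"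
    unfolding green hp_lint_def by (rule tendsto_minus)
  have hn: "h n x = reg_power' (\<epsilon> n) p (g x) * (indicator half_plane x * Q x)" for n x
    by (simp add: h_def)
  have fn: "f x = (p - 1) * \<bar>g x\<bar> powr (p - 2) * (indicator half_plane x * Q x)" for x
    by (simp add: f_def)
  have h0: "0 \<le> h n x" for n x
    unfolding hn by (intro mult_nonneg_nonneg Qpos reg_power'_nonneg \<epsilon> p)
  have hl: "(\<lambda>n. h n x) \<longlonglongrightarrow> f x" for x
    unfolding hn fn \<epsilon>_def by (intro tendsto_intros reg_power'_tendsto)
  have hb: "h n x \<le> p / (p - 1) * f x" for n x
  proof -
    have "h n x \<le> p * \<bar>g x\<bar> powr (p - 2) * (indicator half_plane x * Q x)"
      unfolding hn by (intro mult_right_mono reg_power'_le \<epsilon> p Qpos)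
    also have "\<dots> = p / (p - 1) * f x"
      using p by (simp add: fn)
    finally show ?thesis .
  qed
  note fatou = integral_fatou_dominated[OF ih h0 hl hb c]
  show ?I
    using integrable_mult_right[OF fatou(1), of "1 / (p - 1)"] p by (simp add: f_def Q_def)
  show ?E
    using fatou(2) by (simp add: f_def Q_def L_def hp_lint_def)
qed

text \<open>The integrand is \<open>\<partial>\<^sub>r |g|\<^sup>p / p\<close> and \<open>|g|\<^sup>p\<close> vanishes on the axis. This disposes of the
  part \<open>- 2 \<Gamma>\<^sub>r / r\<close> of the diffusion that lies outside its divergence form, and of the cross term
  that appears when \<open>|F|\<^sup>p\<^sup>/\<^sup>2\<close> is replaced by \<open>|\<Gamma>|\<^sup>p\<^sup>/\<^sup>2\<close>.\<close>

lemma radial_power_derivative_integral: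
  assumes p: "p > 1" and axis: "\<And>z. g (0, z) = 0"
  shows "hp_lint (\<lambda>x. signed_power (p - 1) (g x) * gr x) = 0"
proof -
  have p1: "p - 1 > 0"
    using p by simp
  have eq: "\<bar>s\<bar> powr p = signed_power (p - 1) s * s" for s :: real
    by (cases "s = 0") (auto simp: signed_power_def powr_diff sgn_if)
  have "hp_lint (\<lambda>x. p * (signed_power (p - 1) (g x) * gr x)) = 0"
  proof (rule hp_lint_radial_derivative[where f = "\<lambda>x. \<bar>g x\<bar> powr p"])
    show "rapid1 (\<lambda>x. \<bar>g x\<bar> powr p)"
      unfolding eq by (intro rapid_mult_compose continuous_signed_power p1 rapid_g)
    show "((\<lambda>r. \<bar>g (r, z)\<bar> powr p) has_real_derivative
        p * (signed_power (p - 1) (g (r, z)) * gr (r, z))) (at r)" for r z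
      using compose_dr[OF abs_powr_has_derivative[OF p]] by (simp add: mult.assoc)
      show "rapid1 (\<lambda>x. p * (signed_power (p - 1) (g x) * gr x))"
      by (rule rapid_cmult, rule rapid_mult_compose[OF continuous_signed_power[OF p1] rapid_g rapid_gr])
  qed (use axis in simp)
  then show ?thesis
    using p by (simp add: hp_lint_cmult)
qed

text \<open>Incompressibility says that \<open>(r a, r w)\<close> is divergence-free in the half-plane. Hence
  \<open>p\<close> times the integrand is the divergence of \<open>|g|\<^sup>p (r a, r w)\<close>, whose flux through the axis is
  zero.\<close>

lemma transport_integral:
  assumes p: "p > 1"
    and a: "rapid1 a" "rapid1 ar" "\<And>r z. ((\<lambda>r. a (r, z)) has_real_derivative ar (r, z)) (at r)"
    and w: "rapid1 w" "rapid1 wz" "\<And>r z. ((\<lambda>z. w (r, z)) has_real_derivative wz (r, z)) (at z)"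
    and div: "\<And>r z. r > 0 \<Longrightarrow> a (r, z) + r * ar (r, z) + r * wz (r, z) = 0"
  shows "hp_lint (\<lambda>x. signed_power (p - 1) (g x) * (fst x * (a x * gr x + w x * gz x))) = 0"
proof -
  have p1: "p - 1 > 0" "p > 0"
    using p by simp_all
  note rapid_intros = rapid_mult_compose[OF continuous_signed_power[OF p1(1)] rapid_g]
    rapid_mult_compose[OF continuous_abs_powr[OF p1(2)] rapid_g] rapid_cmult
    rapid_add rapid_mult_fst rapid_mult rapid_g rapid_gr rapid_gz a(1,2) w(1,2)
  \<comment> \<open>the radial and the axial part of the divergence of \<open>|g|\<^sup>p (r a, r w)\<close>\<close>
  have 1: "hp_lint (\<lambda>x. p * (signed_power (p - 1) (g x) * (fst x * (a x * gr x)))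
      + \<bar>g x\<bar> powr p * (a x + fst x * ar x)) = 0"
  proof (rule hp_lint_radial_derivative[where f = "\<lambda>x. \<bar>g x\<bar> powr p * (fst x * a x)"])
    show "((\<lambda>r. \<bar>g (r, z)\<bar> powr p * (fst (r, z) * a (r, z))) has_real_derivative
        p * (signed_power (p - 1) (g (r, z)) * (fst (r, z) * (a (r, z) * gr (r, z)))) +
        \<bar>g (r, z)\<bar> powr p * (a (r, z) + fst (r, z) * ar (r, z))) (at r)" for r z
      by (rule derivative_eq_intros compose_dr[OF abs_powr_has_derivative[OF p]] a(3) refl
          | simp add: algebra_simps)+
  qed (intro rapid_intros | simp)+
  have 2: "hp_lint (\<lambda>x. p * (signed_power (p - 1) (g x) * (fst x * (w x * gz x)))
      + \<bar>g x\<bar> powr p * (fst x * wz x)) = 0"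
  proof (rule hp_lint_axial_derivative[where f = "\<lambda>x. \<bar>g x\<bar> powr p * (fst x * w x)"])
    show "((\<lambda>z. \<bar>g (r, z)\<bar> powr p * (fst (r, z) * w (r, z))) has_real_derivative
        p * (signed_power (p - 1) (g (r, z)) * (fst (r, z) * (w (r, z) * gz (r, z)))) +
        \<bar>g (r, z)\<bar> powr p * (fst (r, z) * wz (r, z))) (at z)" for r z
      by (rule derivative_eq_intros compose_dz[OF abs_powr_has_derivative[OF p]] w(3) refl
          | simp add: algebra_simps)+
  qed (intro rapid_intros | simp)+
  have "0 = hp_lint (\<lambda>x. (p * (signed_power (p - 1) (g x) * (fst x * (a x * gr x)))
        + \<bar>g x\<bar> powr p * (a x + fst x * ar x)) +
      (p * (signed_power (p - 1) (g x) * (fst x * (w x * gz x))) + \<bar>g x\<bar> powr p * (fst x * wz x)))"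
    using 1 2 by (subst hp_lint_add) (intro rapid_intros | simp)+
  also have "\<dots> = hp_lint (\<lambda>x. p * (signed_power (p - 1) (g x) * (fst x * (a x * gr x + w x * gz x))))"
  proof (rule hp_lint_cong)
    fix r z :: real assume "r > 0"
    from div[OF this, of z] have "\<bar>g (r, z)\<bar> powr p * (a (r, z) + r * ar (r, z) + r * wz (r, z)) = 0"
      by simp
    then show "p * (signed_power (p - 1) (g (r, z)) * (fst (r, z) * (a (r, z) * gr (r, z))))
        + \<bar>g (r, z)\<bar> powr p * (a (r, z) + fst (r, z) * ar (r, z)) +
        (p * (signed_power (p - 1) (g (r, z)) * (fst (r, z) * (w (r, z) * gz (r, z))))
        + \<bar>g (r, z)\<bar> powr p * (fst (r, z) * wz (r, z))) =
        p * (signed_power (p - 1) (g (r, z)) * (fst (r, z) * (a (r, z) * gr (r, z) + w (r, z) * gz (r, z))))"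
      by (simp add: algebra_simps)
  qed
  finally show ?thesis
    using p by (simp add: hp_lint_cmult)
qed

end

section \<open>Gradients of half powers\<close>

lemma locally_lipschitz_at:
  assumes "f differentiable (at x)"
  obtains B where "B \<ge> 0" "\<forall>\<^sub>F y in nhds x. norm (f y - f x) \<le> B * norm (y - x)"
proof -
  obtain f' where f': "(f has_derivative f') (at x)"
    using assms by (auto simp: differentiable_def)
  then have bl: "bounded_linear f'"
    by (rule has_derivative_bounded_linear)
  obtain d where d: "d > 0" "\<And>y. norm (y - x) < d \<Longrightarrow> norm (f y - f x - f' (y - x)) \<le> 1 * norm (y - x)"
    using f' unfolding has_derivative_at_alt by (metis zero_less_one)
  have "norm (f y - f x) \<le> (1 + onorm f') * norm (y - x)" if "dist y x < d" for y
  proof -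
    have "norm (f y - f x) \<le> norm (f y - f x - f' (y - x)) + norm (f' (y - x))"
      using norm_triangle_ineq[of "f y - f x - f' (y - x)" "f' (y - x)"] by simp
    also have "\<dots> \<le> 1 * norm (y - x) + onorm f' * norm (y - x)"
      using d(2)[of y] onorm[OF bl, of "y - x"] that by (intro add_mono) (auto simp: dist_norm)
    finally show ?thesis
      by (simp add: distrib_right)
  qed
  then have "\<forall>\<^sub>F y in nhds x. norm (f y - f x) \<le> (1 + onorm f') * norm (y - x)"
    using d(1) unfolding eventually_nhds_metric by blast
  then show ?thesis
    using that[of "1 + onorm f'"] onorm_pos_le[OF bl] by simp
qed

text \<open>The gradient vanishes at \<open>x\<close> and is differentiable there, so it grows at most linearly; the
  mean value inequality along the segment from \<open>x\<close> to \<open>y\<close> gains one more order.\<close>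

lemma quadratic_bound_at_critical_zero:
  fixes g gr gz :: "real \<times> real \<Rightarrow> real"
  assumes Dg: "\<And>x. (g has_derivative (\<lambda>h. fst h * gr x + snd h * gz x)) (at x)"
    and dr: "gr differentiable (at x)" and dz: "gz differentiable (at x)"
    and crit: "g x = 0" "gr x = 0" "gz x = 0"
  obtains C where "C \<ge> 0" "\<forall>\<^sub>F y in nhds x. \<bar>g y\<bar> \<le> C * (norm (y - x))\<^sup>2"
proof -
  obtain A where A: "A \<ge> 0" "\<forall>\<^sub>F y in nhds x. \<bar>gr y\<bar> \<le> A * norm (y - x)"
    using locally_lipschitz_at[OF dr] crit by auto
  obtain B where B: "B \<ge> 0" "\<forall>\<^sub>F y in nhds x. \<bar>gz y\<bar> \<le> B * norm (y - x)"
    using locally_lipschitz_at[OF dz] crit by auto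
  obtain d where d: "d > 0" "\<And>y. dist y x < d \<Longrightarrow> \<bar>gr y\<bar> \<le> A * norm (y - x) \<and> \<bar>gz y\<bar> \<le> B * norm (y - x)"
    using eventually_conj[OF A(2) B(2)] unfolding eventually_nhds_metric by blast
  have "\<bar>g y\<bar> \<le> (A + B) * (norm (y - x))\<^sup>2" if y: "dist y x < d" for y
  proof -
    have "norm (g y - g x) \<le> ((A + B) * norm (y - x)) * norm (y - x)"
    proof (rule differentiable_bound[of "closed_segment x y"])
      fix \<xi> assume \<xi>: "\<xi> \<in> closed_segment x y"
      have le: "norm (\<xi> - x) \<le> norm (y - x)"
        using segment_bound[OF \<xi>] by (simp add: norm_minus_commute)
      then have "dist \<xi> x < d"
        using y by (simp add: dist_norm)
      then have "\<bar>gr \<xi>\<bar> \<le> A * norm (y - x)" "\<bar>gz \<xi>\<bar> \<le> B * norm (y - x)"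
        using d(2)[of \<xi>] mult_left_mono[OF le A(1)] mult_left_mono[OF le B(1)] by auto
      then have s: "\<bar>gr \<xi>\<bar> + \<bar>gz \<xi>\<bar> \<le> (A + B) * norm (y - x)"
        by (simp add: distrib_right)
      show "onorm (\<lambda>h. fst h * gr \<xi> + snd h * gz \<xi>) \<le> (A + B) * norm (y - x)"
      proof (rule onorm_le)
        fix h :: "real \<times> real"
        have h: "\<bar>fst h\<bar> \<le> norm h" "\<bar>snd h\<bar> \<le> norm h"
          using norm_fst_le[of "fst h" "snd h"] norm_snd_le[of "snd h" "fst h"] by simp_all
        have "norm (fst h * gr \<xi> + snd h * gz \<xi>) \<le> \<bar>fst h\<bar> * \<bar>gr \<xi>\<bar> + \<bar>snd h\<bar> * \<bar>gz \<xi>\<bar>"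
          using abs_triangle_ineq[of "fst h * gr \<xi>" "snd h * gz \<xi>"] by (simp add: abs_mult)
        also have "\<dots> \<le> norm h * \<bar>gr \<xi>\<bar> + norm h * \<bar>gz \<xi>\<bar>"
          using h by (intro add_mono mult_right_mono) auto
        also have "\<dots> = (\<bar>gr \<xi>\<bar> + \<bar>gz \<xi>\<bar>) * norm h"
          by (simp add: algebra_simps)
        also have "\<dots> \<le> ((A + B) * norm (y - x)) * norm h"
          using s by (intro mult_right_mono) auto
        finally show "norm (fst h * gr \<xi> + snd h * gz \<xi>) \<le> (A + B) * norm (y - x) * norm h" .
      qed
    qed (auto intro: has_derivative_at_withinI Dg)
    then show ?thesis
      using crit by (simp add: power2_eq_square)
  qed
  then have "\<forall>\<^sub>F y in nhds x. \<bar>g y\<bar> \<le> (A + B) * (norm (y - x))\<^sup>2"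
    using d(1) unfolding eventually_nhds_metric by blast
  then show ?thesis
    using that[of "A + B"] A(1) B(1) by simp
qed

text \<open>Away from the zeros of \<open>g\<close> this is the chain rule. At a critical zero \<open>|g|\<close> is at most
  quadratic, so its power \<open>p / 2\<close> is of order \<open>p > 1\<close> and has derivative zero, which is also the
  value of the formula since \<open>signed_power q 0 = 0\<close>. Zeros that are not critical form a null set by
  \<open>AE_critical_zeros\<close>.\<close>

lemma half_power_has_derivative:
  fixes g gr gz :: "real \<times> real \<Rightarrow> real"
  assumes p: "p > 1"
    and Dg: "\<And>x. (g has_derivative (\<lambda>h. fst h * gr x + snd h * gz x)) (at x)"
    and dr: "gr differentiable (at x)" and dz: "gz differentiable (at x)"
    and crit: "g x = 0 \<longrightarrow> gr x = 0 \<and> gz x = 0"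
  shows "((\<lambda>y. \<bar>g y\<bar> powr (p / 2)) has_derivative
    (\<lambda>h. p / 2 * signed_power (p / 2 - 1) (g x) * (fst h * gr x + snd h * gz x))) (at x)"
proof (cases "g x = 0")
  case True
  then have "gr x = 0" "gz x = 0"
    using crit by simp_all
  then obtain C where C: "C \<ge> 0" "\<forall>\<^sub>F y in nhds x. \<bar>g y\<bar> \<le> C * (norm (y - x))\<^sup>2"
    by (rule quadratic_bound_at_critical_zero[OF Dg dr dz True])
  have "((\<lambda>y. \<bar>g y\<bar> powr (p / 2)) has_derivative (\<lambda>_. 0)) (at x)"
  proof (rule has_derivative_zero_if_powr_bound[OF p])
    show "\<forall>\<^sub>F y in at x. norm (\<bar>g y\<bar> powr (p / 2) - \<bar>g x\<bar> powr (p / 2))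
        \<le> C powr (p / 2) * norm (y - x) powr p"
      using eventually_nhds_conv_at[THEN iffD1, OF C(2), THEN conjunct1]
    proof (rule eventually_mono)
      fix y assume y: "\<bar>g y\<bar> \<le> C * (norm (y - x))\<^sup>2"
      have "\<bar>g y\<bar> powr (p / 2) \<le> (C * (norm (y - x))\<^sup>2) powr (p / 2)"
        using y p by (intro powr_mono2) auto
      also have "\<dots> = C powr (p / 2) * ((norm (y - x))\<^sup>2) powr (p / 2)"
        using C(1) by (simp add: powr_mult)
      also have "((norm (y - x))\<^sup>2) powr (p / 2) = norm (y - x) powr p"
        by (cases "y = x") (simp_all add: powr_powr flip: powr_numeral)
      finally show "norm (\<bar>g y\<bar> powr (p / 2) - \<bar>g x\<bar> powr (p / 2)) \<le> C powr (p / 2) * norm (y - x) powr p"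
        using True by simp
    qed
  qed
  then show ?thesis
    using True by (simp add: signed_power_def)
next
  case False
  have "((\<lambda>s. \<bar>s\<bar> powr (p / 2)) has_derivative (\<lambda>h. p / 2 * signed_power (p / 2 - 1) (g x) * h)) (at (g x))"
    by (rule abs_powr_has_derivative_nonzero[OF False, of "p / 2", unfolded has_field_derivative_def])
  from has_derivative_compose[OF Dg this] show ?thesis .
qed

lemma norm_pair_squared: "(norm (a :: real, b :: real))\<^sup>2 = a\<^sup>2 + b\<^sup>2"
  by (simp add: norm_Pair)

lemma hp_grad_eq:
  assumes "((\<lambda>(r, z). f r z) has_derivative D) (at (r, z))"
  shows "hp_grad f r z = (D (1, 0), D (0, 1))"
proof -
  have lin: "linear D"
    using assms by (rule has_derivative_linear)
  have sr: "D (h, 0) = h * D (1, 0)" and sz: "D (0, h) = h * D (0, 1)" for h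
    using linear_scale[OF lin, of h "(1, 0)"] linear_scale[OF lin, of h "(0, 1)"] by simp_all
  have "((\<lambda>r. (r, z)) has_derivative (\<lambda>h. (h, 0))) (at r)"
    by (auto intro!: derivative_eq_intros)
  from has_derivative_compose[OF this, of "\<lambda>(r, z). f r z" D]
  have 1: "((\<lambda>r. f r z) has_derivative (\<lambda>h. h * D (1, 0))) (at r)"
    using assms by (simp add: sr[symmetric])
  have "((\<lambda>z. (r, z)) has_derivative (\<lambda>h. (0, h))) (at z)"
    by (auto intro!: derivative_eq_intros)
  from has_derivative_compose[OF this, of "\<lambda>(r, z). f r z" D]
  have 2: "((\<lambda>z. f r z) has_derivative (\<lambda>h. h * D (0, 1))) (at z)"
    using assms by (simp add: sz[symmetric])
  show ?thesis
    using 1 2 by (auto simp: hp_grad_def has_field_derivative_def mult_commute_abs intro!: DERIV_imp_deriv)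
qed

lemma signed_power_half_squared: "(signed_power (p / 2 - 1) s)\<^sup>2 = \<bar>s\<bar> powr (p - 2)"
proof (cases "s = 0")
  case False
  have "(signed_power (p / 2 - 1) s)\<^sup>2 = \<bar>signed_power (p / 2 - 1) s\<bar> * \<bar>signed_power (p / 2 - 1) s\<bar>"
    unfolding power2_eq_square by (rule abs_mult_self_eq[symmetric])
  then show ?thesis
    unfolding abs_signed_power by (simp add: powr_add[symmetric])
qed (simp add: signed_power_def)

lemma signed_power_half_mult: "signed_power (p / 2 - 1) s * \<bar>s\<bar> powr (p / 2) = signed_power (p - 1) s"
  by (simp add: signed_power_def mult.assoc powr_add[symmetric])

lemma abs_powr_half_squared: "(\<bar>s :: real\<bar> powr (p / 2))\<^sup>2 = \<bar>s\<bar> powr p"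
  by (simp add: power2_eq_square powr_add[symmetric])

lemma circulation_gradient:
  assumes r: "r > 0"
    and D: "((\<lambda>y. \<bar>g y\<bar> powr (p / 2)) has_derivative
      (\<lambda>h. p / 2 * signed_power (p / 2 - 1) (g (r, z)) * (fst h * gr (r, z) + snd h * gz (r, z)))) (at (r, z))"
    and f: "\<And>r z. r > 0 \<Longrightarrow> f r z = \<bar>g (r, z)\<bar> powr (p / 2)"
  shows "(\<lambda>(r, z). f r z) differentiable (at (r, z))"
    and "(norm (hp_grad f r z))\<^sup>2 * r =
      p\<^sup>2 / 4 * (\<bar>g (r, z)\<bar> powr (p - 2) * (r * ((gr (r, z))\<^sup>2 + (gz (r, z))\<^sup>2)))"
proof -
  have op: "open half_plane"
    unfolding half_plane_def by (intro open_Times) auto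
  have Df: "((\<lambda>(r, z). f r z) has_derivative
      (\<lambda>h. p / 2 * signed_power (p / 2 - 1) (g (r, z)) * (fst h * gr (r, z) + snd h * gz (r, z)))) (at (r, z))"
    by (rule has_derivative_transform_within_open[OF D op]) (use r f in \<open>auto simp: half_plane_def\<close>)
  show "(\<lambda>(r, z). f r z) differentiable (at (r, z))"
    using Df by (auto simp: differentiable_def)
  show "(norm (hp_grad f r z))\<^sup>2 * r =
      p\<^sup>2 / 4 * (\<bar>g (r, z)\<bar> powr (p - 2) * (r * ((gr (r, z))\<^sup>2 + (gz (r, z))\<^sup>2)))"
    unfolding hp_grad_eq[OF Df] signed_power_half_squared[symmetric]
    unfolding norm_pair_squared by (simp add: power2_eq_square algebra_simps)
qed

text \<open>With \<open>H = r\<^sup>-\<^sup>p G\<close>, where \<open>G = |g|\<^sup>p\<^sup>/\<^sup>2\<close>, expanding \<open>|\<nabla>H|\<^sup>2\<close> produces the gradient of \<open>G\<close>, a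
  multiple of \<open>G\<^sup>2 / r\<close>, and the cross term \<open>- 2 p G G\<^sub>r = - p \<partial>\<^sub>r |g|\<^sup>p\<close>. Only the cross term is
  a derivative, so the exchange of the two weighted gradients is exact after integration.\<close>

lemma swirl_rate_gradient:
  assumes r: "r > 0"
    and D: "((\<lambda>y. \<bar>g y\<bar> powr (p / 2)) has_derivative
      (\<lambda>h. p / 2 * signed_power (p / 2 - 1) (g (r, z)) * (fst h * gr (r, z) + snd h * gz (r, z)))) (at (r, z))"
    and f: "\<And>r z. r > 0 \<Longrightarrow> f r z = r powr (- p) * \<bar>g (r, z)\<bar> powr (p / 2)"
  shows "(\<lambda>(r, z). f r z) differentiable (at (r, z))"
    and "(norm (hp_grad f r z))\<^sup>2 * r powr (2 * p + 1) =
      p\<^sup>2 / 4 * (\<bar>g (r, z)\<bar> powr (p - 2) * (r * ((gr (r, z))\<^sup>2 + (gz (r, z))\<^sup>2)))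
      - p\<^sup>2 * (signed_power (p - 1) (g (r, z)) * gr (r, z)) + p\<^sup>2 * (\<bar>g (r, z)\<bar> powr p / r)"
proof -
  define G where "G = \<bar>g (r, z)\<bar> powr (p / 2)"
  define S where "S = p / 2 * signed_power (p / 2 - 1) (g (r, z))"
  let ?gr = "gr (r, z)" and ?gz = "gz (r, z)"
  have op: "open half_plane"
    unfolding half_plane_def by (intro open_Times) auto
  have "((\<lambda>r. r powr (- p)) has_derivative (\<lambda>h. - p * r powr (- p - 1) * h)) (at (fst (r, z)))"
    unfolding fst_conv
    by (rule has_derivative_eq_rhs[OF
          has_real_derivative_powr[OF r, of "- p", unfolded has_field_derivative_def]]) auto
  then have "((\<lambda>x :: real \<times> real. fst x powr (- p)) has_derivative (\<lambda>h. - p * r powr (- p - 1) * fst h)) (at (r, z))"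
    by (rule has_derivative_compose[OF has_derivative_fst[OF has_derivative_ident]])
  from has_derivative_mult[OF this D]
  have "((\<lambda>x. fst x powr (- p) * \<bar>g x\<bar> powr (p / 2)) has_derivative
      (\<lambda>h. r powr (- p) * (S * (fst h * ?gr + snd h * ?gz)) + - p * r powr (- p - 1) * fst h * G)) (at (r, z))"
    by (simp add: S_def G_def)
  then have Df: "((\<lambda>(r, z). f r z) has_derivative
      (\<lambda>h. r powr (- p) * (S * (fst h * ?gr + snd h * ?gz)) + - p * r powr (- p - 1) * fst h * G)) (at (r, z))"
    by (rule has_derivative_transform_within_open[OF _ op]) (use r f in \<open>auto simp: half_plane_def\<close>)
  show "(\<lambda>(r, z). f r z) differentiable (at (r, z))"
    using Df by (auto simp: differentiable_def)
  have q: "r powr (- p - 1) = r powr (- p) / r"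
    using r by (simp add: powr_diff)
  have w: "(r powr (- p))\<^sup>2 * r powr (2 * p + 1) = r"
    using r by (simp add: power2_eq_square powr_add[symmetric])
  have "(norm (hp_grad f r z))\<^sup>2 = (r powr (- p))\<^sup>2 * ((S * ?gr - p * G / r)\<^sup>2 + (S * ?gz)\<^sup>2)"
    unfolding hp_grad_eq[OF Df] q
    unfolding norm_pair_squared by (simp add: power2_eq_square algebra_simps)
  then have "(norm (hp_grad f r z))\<^sup>2 * r powr (2 * p + 1) =
      ((r powr (- p))\<^sup>2 * r powr (2 * p + 1)) * ((S * ?gr - p * G / r)\<^sup>2 + (S * ?gz)\<^sup>2)"
    by (simp add: mult_ac)
  also have "\<dots> = S\<^sup>2 * (r * (?gr\<^sup>2 + ?gz\<^sup>2)) - 2 * p * ((S * G) * ?gr) + p\<^sup>2 * (G\<^sup>2 / r)"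
    unfolding w using r by (simp add: power2_eq_square field_simps)
  also have "S\<^sup>2 = p\<^sup>2 / 4 * \<bar>g (r, z)\<bar> powr (p - 2)"
    by (simp add: S_def power_mult_distrib power_divide signed_power_half_squared)
  also have "S * G = p / 2 * signed_power (p - 1) (g (r, z))"
    by (simp add: S_def G_def mult.assoc signed_power_half_mult)
  also have "G\<^sup>2 = \<bar>g (r, z)\<bar> powr p"
    by (simp add: G_def abs_powr_half_squared)
  finally show "(norm (hp_grad f r z))\<^sup>2 * r powr (2 * p + 1) =
      p\<^sup>2 / 4 * (\<bar>g (r, z)\<bar> powr (p - 2) * (r * ((gr (r, z))\<^sup>2 + (gz (r, z))\<^sup>2)))
      - p\<^sup>2 * (signed_power (p - 1) (g (r, z)) * gr (r, z)) + p\<^sup>2 * (\<bar>g (r, z)\<bar> powr p / r)"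
    by (simp add: power2_eq_square mult.assoc)
qed

section \<open>Differentiation under the integral\<close>

text \<open>The mean value theorem bounds the difference quotients by \<open>w\<close>, so that dominated convergence
  applies along every sequence of times.\<close>

lemma has_real_derivative_integral:
  fixes h h' :: "real \<Rightarrow> 'a \<Rightarrow> real"
  assumes \<delta>: "\<delta> > 0"
    and int: "\<And>s. s \<in> ball t \<delta> \<Longrightarrow> integrable M (h s)"
    and deriv: "\<And>s x. s \<in> ball t \<delta> \<Longrightarrow> ((\<lambda>s. h s x) has_real_derivative h' s x) (at s)"
    and meas: "h' t \<in> borel_measurable M"
    and w: "integrable M w" and bound: "\<And>s x. s \<in> ball t \<delta> \<Longrightarrow> \<bar>h' s x\<bar> \<le> w x"
  shows "((\<lambda>s. integral\<^sup>L M (h s)) has_real_derivative integral\<^sup>L M (h' t)) (at t)"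
  unfolding has_field_derivative_iff tendsto_at_iff_sequentially
proof (intro allI impI)
  fix X :: "nat \<Rightarrow> real" assume X: "\<forall>i. X i \<in> UNIV - {t}" "X \<longlonglongrightarrow> t"
  have t: "t \<in> ball t \<delta>"
    using \<delta> by simp
  have "\<forall>\<^sub>F n in sequentially. X n \<in> ball t \<delta>"
    using topological_tendstoD[OF X(2) open_ball t] .
  then obtain N where N: "\<And>n. n \<ge> N \<Longrightarrow> X n \<in> ball t \<delta>"
    by (auto simp: eventually_sequentially)
  \<comment> \<open>drop the finitely many terms outside the interval on which \<open>w\<close> is a majorant\<close>
  define Y where "Y = (\<lambda>n. X (n + N))"
  have Y: "Y n \<in> ball t \<delta>" "Y n \<noteq> t" for n
    using N X(1) by (auto simp: Y_def)
  have Yt: "Y \<longlonglongrightarrow> t"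
    unfolding Y_def using X(2) by (rule LIMSEQ_ignore_initial_segment)
  have "(\<lambda>n. \<integral>x. (h (Y n) x - h t x) / (Y n - t) \<partial>M) \<longlonglongrightarrow> integral\<^sup>L M (h' t)"
  proof (rule integral_dominated_convergence[OF meas _ w])
    show "(\<lambda>x. (h (Y n) x - h t x) / (Y n - t)) \<in> borel_measurable M" for n
      using int[OF Y(1)] int[OF t] by (intro borel_measurable_divide borel_measurable_diff) auto
    show "AE x in M. (\<lambda>n. (h (Y n) x - h t x) / (Y n - t)) \<longlonglongrightarrow> h' t x"
    proof (rule AE_I2)
      fix x
      have "((\<lambda>s. (h s x - h t x) / (s - t)) \<longlongrightarrow> h' t x) (at t)"
        using deriv[OF t] by (simp add: has_field_derivative_iff)
      then show "(\<lambda>n. (h (Y n) x - h t x) / (Y n - t)) \<longlonglongrightarrow> h' t x"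
        unfolding tendsto_at_iff_sequentially using Y(2) Yt by (auto simp: o_def)
    qed
    show "AE x in M. norm ((h (Y n) x - h t x) / (Y n - t)) \<le> w x" for n
    proof (rule AE_I2)
      fix x
      have "norm (h (Y n) x - h t x) \<le> w x * norm (Y n - t)"
        by (rule field_differentiable_bound[of "ball t \<delta>" "\<lambda>s. h s x" "\<lambda>s. h' s x"])
           (use deriv bound Y t in \<open>auto intro: has_field_derivative_at_within simp del: mem_ball\<close>)
      then show "norm ((h (Y n) x - h t x) / (Y n - t)) \<le> w x"
        using Y(2)[of n] by (simp add: divide_le_eq)
    qed
  qed
  moreover have "(\<integral>x. (h (Y n) x - h t x) / (Y n - t) \<partial>M) =
      (integral\<^sup>L M (h (Y n)) - integral\<^sup>L M (h t)) / (Y n - t)" for n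
    using int[OF Y(1)] int[OF t] by simp
  ultimately have "(\<lambda>n. ((\<lambda>y. (integral\<^sup>L M (h y) - integral\<^sup>L M (h t)) / (y - t)) \<circ> X) (n + N))
      \<longlonglongrightarrow> integral\<^sup>L M (h' t)"
    by (simp only: o_def Y_def)
  then show "((\<lambda>y. (integral\<^sup>L M (h y) - integral\<^sup>L M (h t)) / (y - t)) \<circ> X)
      \<longlonglongrightarrow> integral\<^sup>L M (h' t)"
    by (rule LIMSEQ_offset)
qed

section \<open>Directional derivatives\<close>

lemma differentiable_dderiv:
  "f differentiable (at z) \<Longrightarrow> (f has_derivative (\<lambda>v. dderiv v f z)) (at z)"
  unfolding dderiv_def by (rule iffD1[OF frechet_derivative_works])

lemma dderiv_eqI: "(f has_derivative f') (at z) \<Longrightarrow> dderiv v f z = f' v"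
  unfolding dderiv_def using frechet_derivative_at by metis

lemma dderiv_linear:
  assumes "f differentiable (at z)"
  shows "dderiv (a *\<^sub>R v + b *\<^sub>R w) f z = a *\<^sub>R dderiv v f z + b *\<^sub>R dderiv w f z"
proof -
  have "linear (\<lambda>v. dderiv v f z)"
    using differentiable_dderiv[OF assms] by (rule has_derivative_linear)
  from linear_add[OF this] linear_scale[OF this] show ?thesis
    by simp
qed

lemma dderiv_cong_open:
  assumes "open S" "z \<in> S" "\<And>y. y \<in> S \<Longrightarrow> f y = g y" "f differentiable (at z)"
  shows "dderiv v f z = dderiv v g z"
proof -
  have "(g has_derivative (\<lambda>v. dderiv v f z)) (at z)"
    using has_derivative_transform_within_open[OF differentiable_dderiv[OF assms(4)] assms(1,2,3)] .
  from dderiv_eqI[OF this] show ?thesis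
    by simp
qed

text \<open>The chain rule along a curve in space at a frozen time. Differentiating along circles about the
  axis with this rule is how angular derivatives are computed.\<close>

lemma dderiv_along_curve:
  fixes f :: "(real^3) \<times> real \<Rightarrow> 'b::real_normed_vector"
  assumes f: "f differentiable (at (c \<tau>, s))" and c: "(c has_vector_derivative c') (at \<tau>)"
  shows "((\<lambda>\<tau>. f (c \<tau>, s)) has_vector_derivative dderiv (c', 0) f (c \<tau>, s)) (at \<tau>)"
proof -
  have "((\<lambda>\<tau>. (c \<tau>, s)) has_vector_derivative (c', 0)) (at \<tau>)"
    using c by (intro has_vector_derivative_Pair) (auto intro: derivative_intros)
  from vector_derivative_diff_chain_within[OF this, of f "\<lambda>v. dderiv v f (c \<tau>, s)"]
  show ?thesis
    using has_derivative_at_withinI[OF differentiable_dderiv[OF f]] by (simp add: o_def)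
qed

lemma dtime_has_vector_derivative:
  fixes f :: "(real^3) \<times> real \<Rightarrow> 'b::real_normed_vector"
  assumes f: "f differentiable (at (x, s))"
  shows "((\<lambda>s. f (x, s)) has_vector_derivative dtime f (x, s)) (at s)"
proof -
  have "((\<lambda>s. (x, s)) has_vector_derivative (0, 1)) (at s)"
    by (intro has_vector_derivative_Pair) (auto intro: derivative_intros)
  from vector_derivative_diff_chain_within[OF this, of f "\<lambda>v. dderiv v f (x, s)"]
  show ?thesis
    using has_derivative_at_withinI[OF differentiable_dderiv[OF f]] by (simp add: o_def)
qed

lemma vec3_expansion: "(v :: real^3) = v $ 1 *\<^sub>R axis 1 1 + v $ 2 *\<^sub>R axis 2 1 + v $ 3 *\<^sub>R axis 3 1"
  by (simp add: vec_eq_iff forall_3 axis_def)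

lemma dderiv_space_expansion:
  fixes f :: "(real^3) \<times> real \<Rightarrow> 'b::real_normed_vector"
  assumes "f differentiable (at z)"
  shows "dderiv (v, 0) f z = (\<Sum>i\<in>UNIV. (v $ i) *\<^sub>R dspace i f z)"
proof -
  have lin: "linear (\<lambda>v. dderiv v f z)"
    using differentiable_dderiv[OF assms] by (rule has_derivative_linear)
  have "(v, 0::real) = v $ 1 *\<^sub>R (axis 1 1, 0) + v $ 2 *\<^sub>R (axis 2 1, 0) + v $ 3 *\<^sub>R (axis 3 1, 0)"
    using vec3_expansion[of v] by simp
  then show ?thesis
    by (simp only: linear_add[OF lin] linear_scale[OF lin] sum_3)
qed

section \<open>Rotations about the axis\<close>

definition rot :: "real \<Rightarrow> real^3 \<Rightarrow> real^3" where
  "rot \<phi> x = vector [cos \<phi> * x $ 1 - sin \<phi> * x $ 2, sin \<phi> * x $ 1 + cos \<phi> * x $ 2, x $ 3]"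

text \<open>The generator of the rotations: \<open>e\<^sub>z \<times> x\<close>.\<close>

definition quarter_turn :: "real^3 \<Rightarrow> real^3" where
  "quarter_turn x = vector [- (x $ 2), x $ 1, 0]"

text \<open>The cylindrical components are prescribed for \<open>r > 0\<close> only, so the symmetry of \<open>u\<close> is known
  on this open set.\<close>

definition off_axis :: "(real^3) set" where
  "off_axis = {x. x $ 1 \<noteq> 0 \<or> x $ 2 \<noteq> 0}"

lemma rot_nth [simp]:
  "rot \<phi> x $ 1 = cos \<phi> * x $ 1 - sin \<phi> * x $ 2"
  "rot \<phi> x $ 2 = sin \<phi> * x $ 1 + cos \<phi> * x $ 2"
  "rot \<phi> x $ 3 = x $ 3"
  by (simp_all add: rot_def)

lemma quarter_turn_nth [simp]:
  "quarter_turn x $ 1 = - (x $ 2)" "quarter_turn x $ 2 = x $ 1" "quarter_turn x $ 3 = 0"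
  by (simp_all add: quarter_turn_def)

lemma linear_rot: "linear (rot \<phi>)"
  by (rule linearI) (simp_all add: vec_eq_iff forall_3 algebra_simps)

lemma bounded_linear_rot: "bounded_linear (rot \<phi>)"
  using linear_rot linear_conv_bounded_linear by blast

lemma rot_0 [simp]: "rot 0 x = x" and rot_2pi [simp]: "rot (2 * pi) x = x"
  by (simp_all add: vec_eq_iff forall_3)

lemma inner_rot: "rot \<phi> x \<bullet> rot \<phi> y = x \<bullet> y"
proof -
  have "rot \<phi> x \<bullet> rot \<phi> y = ((sin \<phi>)\<^sup>2 + (cos \<phi>)\<^sup>2) * (x $ 1 * y $ 1 + x $ 2 * y $ 2) + x $ 3 * y $ 3"
    by (simp add: inner_vec_def sum_3 algebra_simps power2_eq_square
        del: sin_cos_squared_add sin_cos_squared_add2 sin_cos_squared_add3)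
  then show ?thesis
    by (simp add: inner_vec_def sum_3)
qed

lemma rot_cyl: "rot \<phi> (cyl r \<theta> z) = cyl r (\<theta> + \<phi>) z"
  by (simp add: vec_eq_iff forall_3 cyl_def cos_add sin_add algebra_simps)

lemma open_off_axis: "open off_axis"
  unfolding off_axis_def Collect_disj_eq
  by (intro open_Un open_Collect_neq continuous_intros)

lemma off_axis_cylE:
  assumes "x \<in> off_axis"
  obtains r \<theta> z where "r > 0" "x = cyl r \<theta> z"
proof -
  define r where "r = sqrt ((x $ 1)\<^sup>2 + (x $ 2)\<^sup>2)"
  have pos: "(x $ 1)\<^sup>2 + (x $ 2)\<^sup>2 > 0"
    using assms by (auto simp: off_axis_def sum_power2_gt_zero_iff)
  have r: "r > 0" "r\<^sup>2 = (x $ 1)\<^sup>2 + (x $ 2)\<^sup>2"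
    using pos by (simp_all add: r_def)
  have "(x $ 1 / r)\<^sup>2 + (x $ 2 / r)\<^sup>2 = 1"
    unfolding power_divide add_divide_distrib[symmetric] r(2)[symmetric] using r(1) by simp
  then obtain \<theta> where \<theta>: "x $ 1 / r = cos \<theta>" "x $ 2 / r = sin \<theta>"
    by (rule sincos_total_2pi)
  have "x = cyl r \<theta> (x $ 3)"
    using \<theta> r by (simp add: vec_eq_iff forall_3 cyl_def field_simps)
  then show ?thesis
    using that r by blast
qed

lemma rot_has_vector_derivative:
  "((\<lambda>\<phi>. rot \<phi> x) has_vector_derivative rot \<phi> (quarter_turn x)) (at \<phi>)"
proof -
  have eq: "rot \<phi> x = (cos \<phi> * x $ 1 - sin \<phi> * x $ 2) *\<^sub>R axis 1 1
      + (sin \<phi> * x $ 1 + cos \<phi> * x $ 2) *\<^sub>R axis 2 1 + (x $ 3) *\<^sub>R axis 3 1" for \<phi> x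
    using vec3_expansion[of "rot \<phi> x"] by simp
  show ?thesis
    unfolding eq
    by (auto intro!: derivative_eq_intros simp: has_real_derivative_iff_has_vector_derivative[symmetric])
qed

text \<open>Differentiating the symmetry relation along a line. The relation is between two possibly
  different fields because the derivative of a symmetric field in a fixed direction is no longer
  symmetric: rotating it also rotates the direction. In this form the lemma can be iterated.\<close>

lemma rot_equivariant_dderiv:
  fixes t :: real
  assumes f: "\<And>x. f differentiable (at (x, t))" and g: "\<And>x. g differentiable (at (x, t))"
    and eq: "\<And>x. x \<in> off_axis \<Longrightarrow> f (rot \<phi> x, t) = rot \<phi> (g (x, t))"
    and x: "x \<in> off_axis"
  shows "dderiv (rot \<phi> v, 0) f (rot \<phi> x, t) = rot \<phi> (dderiv (v, 0) g (x, t))"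
proof -
  define c where "c = (\<lambda>\<tau>. x + \<tau> *\<^sub>R v)"
  have c: "(c has_vector_derivative v) (at 0)" and c0: "c 0 = x"
    unfolding c_def by (auto intro!: derivative_eq_intros)
  have rc: "((\<lambda>\<tau>. rot \<phi> (c \<tau>)) has_vector_derivative rot \<phi> v) (at 0)"
    using bounded_linear.has_vector_derivative[OF bounded_linear_rot c] .
  have 1: "((\<lambda>\<tau>. f (rot \<phi> (c \<tau>), t)) has_vector_derivative dderiv (rot \<phi> v, 0) f (rot \<phi> x, t)) (at 0)"
    using dderiv_along_curve[OF f rc] by (simp add: c0)
  have 2: "((\<lambda>\<tau>. rot \<phi> (g (c \<tau>, t))) has_vector_derivative rot \<phi> (dderiv (v, 0) g (x, t))) (at 0)"
    using bounded_linear.has_vector_derivative[OF bounded_linear_rot dderiv_along_curve[OF g c]]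
    by (simp add: c0)
  have "open (c -` off_axis)"
    using open_off_axis by (rule open_vimage) (auto simp: c_def intro!: continuous_intros)
  then have "((\<lambda>\<tau>. rot \<phi> (g (c \<tau>, t))) has_vector_derivative dderiv (rot \<phi> v, 0) f (rot \<phi> x, t)) (at 0)"
    by (rule has_vector_derivative_transform_within_open[OF 1]) (use x eq in \<open>auto simp: c0\<close>)
  then show ?thesis
    using 2 vector_derivative_unique_at by blast
qed

section \<open>The flow in the meridional plane\<close>

text \<open>The half-plane \<open>\<theta> = 0\<close>, continued to \<open>r \<le> 0\<close>. Restricting the Cartesian field to this plane
  gives cylindrical components that are smooth across the axis.\<close>

definition merid :: "real \<times> real \<Rightarrow> real^3" where
  "merid x = fst x *\<^sub>R axis 1 1 + snd x *\<^sub>R axis 3 1"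

lemma merid_nth [simp]: "merid x $ 1 = fst x" "merid x $ 2 = 0" "merid x $ 3 = snd x"
  by (simp_all add: merid_def axis_def)

lemma merid_eq_cyl: "merid (r, z) = cyl r 0 z"
  by (simp add: vec_eq_iff forall_3 cyl_def)

lemma norm_merid [simp]: "norm (merid x) = norm x"
  by (cases x) (simp add: norm_vec_def L2_set_def sum_3 norm_Pair)

text \<open>Iterated space derivatives in the form in which smoothness and decay are stated, with the
  outermost direction first.\<close>

definition space_deriv :: "(real^3) list \<Rightarrow> ((real^3) \<times> real \<Rightarrow> real^3) \<Rightarrow> (real^3) \<times> real \<Rightarrow> real^3" where
  "space_deriv vs u = foldr dderiv (map (\<lambda>v. (v, 0)) vs) u"

lemma space_deriv_Nil [simp]: "space_deriv [] u = u"
  and space_deriv_Cons: "space_deriv (v # vs) u = dderiv (v, 0) (space_deriv vs u)"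
  by (simp_all add: space_deriv_def)

definition merid_comp ::
  "((real^3) \<times> real \<Rightarrow> real^3) \<Rightarrow> (real^3) list \<Rightarrow> 3 \<Rightarrow> real \<Rightarrow> real \<times> real \<Rightarrow> real" where
  "merid_comp u vs i s x = space_deriv vs u (merid x, s) $ i"

lemma space_deriv_differentiable:
  "smooth_on_open (UNIV \<times> I) u \<Longrightarrow> s \<in> I \<Longrightarrow> space_deriv vs u differentiable (at (x, s))"
  unfolding smooth_on_open_def space_deriv_def by simp

lemma merid_comp_has_derivative:
  assumes "smooth_on_open (UNIV \<times> I) u" "s \<in> I"
  shows "(merid_comp u vs i s has_derivative
    (\<lambda>h. fst h * merid_comp u (axis 1 1 # vs) i s x + snd h * merid_comp u (axis 3 1 # vs) i s x)) (at x)"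
proof -
  let ?f = "space_deriv vs u"
  have d: "?f differentiable (at (merid x, s))"
    using space_deriv_differentiable[OF assms] .
  have m: "((\<lambda>x. (merid x, s)) has_derivative (\<lambda>h. (merid h, 0))) (at x)"
    unfolding merid_def by (auto intro!: derivative_eq_intros)
  have "((\<lambda>x. ?f (merid x, s)) has_derivative (\<lambda>h. dderiv (merid h, 0) ?f (merid x, s))) (at x)"
    using has_derivative_compose[OF m differentiable_dderiv[OF d]] .
  then have "((\<lambda>x. ?f (merid x, s) $ i) has_derivative
      (\<lambda>h. dderiv (merid h, 0) ?f (merid x, s) $ i)) (at x)"
    by (rule bounded_linear.has_derivative[OF bounded_linear_vec_nth])
  moreover have "dderiv (merid h, 0) ?f (merid x, s) $ i =
      fst h * merid_comp u (axis 1 1 # vs) i s x + snd h * merid_comp u (axis 3 1 # vs) i s x" for h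
  proof -
    have "(merid h, 0::real) = fst h *\<^sub>R (axis 1 1, 0) + snd h *\<^sub>R (axis 3 1, 0)"
      by (simp add: merid_def)
    then have "dderiv (merid h, 0) ?f (merid x, s) =
        fst h *\<^sub>R dspace 1 ?f (merid x, s) + snd h *\<^sub>R dspace 3 ?f (merid x, s)"
      by (simp only: dderiv_linear[OF d])
    then show ?thesis
      by (simp add: merid_comp_def space_deriv_Cons)
  qed
  ultimately show ?thesis
    by (simp add: merid_comp_def[abs_def])
qed

lemma merid_comp_dr:
  assumes "smooth_on_open (UNIV \<times> I) u" "s \<in> I"
  shows "((\<lambda>r. merid_comp u vs i s (r, z)) has_real_derivative merid_comp u (axis 1 1 # vs) i s (r, z)) (at r)"
proof -
  have "((\<lambda>r. (r, z)) has_derivative (\<lambda>h. (h, 0))) (at r)"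
    by (auto intro!: derivative_eq_intros)
  from has_derivative_compose[OF this merid_comp_has_derivative[OF assms, of vs i]]
  show ?thesis
    by (simp add: has_field_derivative_def mult_commute_abs)
qed

lemma merid_comp_dz:
  assumes "smooth_on_open (UNIV \<times> I) u" "s \<in> I"
  shows "((\<lambda>z. merid_comp u vs i s (r, z)) has_real_derivative merid_comp u (axis 3 1 # vs) i s (r, z)) (at z)"
proof -
  have "((\<lambda>z. (r, z)) has_derivative (\<lambda>h. (0, h))) (at z)"
    by (auto intro!: derivative_eq_intros)
  from has_derivative_compose[OF this merid_comp_has_derivative[OF assms, of vs i]]
  show ?thesis
    by (simp add: has_field_derivative_def mult_commute_abs)
qed

lemma merid_comp_dt:
  assumes "smooth_on_open (UNIV \<times> I) u" "s \<in> I"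
  shows "((\<lambda>s. merid_comp u [] i s x) has_real_derivative dtime u (merid x, s) $ i) (at s)"
  using bounded_linear.has_vector_derivative[OF bounded_linear_vec_nth
      dtime_has_vector_derivative[OF space_deriv_differentiable[OF assms, of "[]"]]]
  by (simp add: merid_comp_def has_real_derivative_iff_has_vector_derivative)

text \<open>Decay is stated with the weights \<open>|x|\<^sup>N\<close>, which degenerate at the origin; the weights of
  orders \<open>0\<close> and \<open>N\<close> together control \<open>(1 + |x|)\<^sup>N\<close>.\<close>

lemma rapid_merid_comp:
  assumes smooth: "smooth_on_open (UNIV \<times> I) u" and decay: "rapidly_decaying I u"
    and K: "compact K" "K \<subseteq> I"
  shows "rapid K (merid_comp u vs i)"
proof (rule rapidI)
  fix s assume "s \<in> K"
  then have "s \<in> I"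
    using K by blast
  then show "continuous_on UNIV (merid_comp u vs i s)"
    using merid_comp_has_derivative[OF smooth] has_derivative_continuous
    by (intro continuous_at_imp_continuous_on) blast
next
  fix N
  have ex: "\<exists>C. \<forall>x. \<forall>s\<in>K. norm x ^ N * norm (space_deriv vs u (x, s)) \<le> C" for N
    using decay K unfolding rapidly_decaying_def space_deriv_def by blast
  obtain C where C: "\<And>x s. s \<in> K \<Longrightarrow> norm x ^ 0 * norm (space_deriv vs u (x, s)) \<le> C"
    using ex[of 0] by metis
  obtain D where D: "\<And>x s. s \<in> K \<Longrightarrow> norm x ^ N * norm (space_deriv vs u (x, s)) \<le> D"
    using ex[of N] by metis
  have "(1 + norm x) ^ N * \<bar>merid_comp u vs i s x\<bar> \<le> 2 ^ N * (C + D)" if s: "s \<in> K" for s x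
  proof -
    let ?n = "norm x" and ?y = "norm (space_deriv vs u (merid x, s))"
    have "(1 + ?n) ^ N \<le> (2 * max 1 ?n) ^ N"
      by (intro power_mono) auto
    also have "\<dots> \<le> 2 ^ N * (1 + ?n ^ N)"
      by (auto simp: power_mult_distrib max_def)
    finally have 1: "(1 + ?n) ^ N \<le> 2 ^ N * (1 + ?n ^ N)" .
    have 2: "\<bar>merid_comp u vs i s x\<bar> \<le> ?y"
      unfolding merid_comp_def by (rule component_le_norm_cart)
    have "(1 + ?n) ^ N * \<bar>merid_comp u vs i s x\<bar> \<le> (2 ^ N * (1 + ?n ^ N)) * ?y"
      using 1 2 by (intro mult_mono) auto
    also have "\<dots> = 2 ^ N * (?y + ?n ^ N * ?y)"
      by (simp add: algebra_simps)
    also have "\<dots> \<le> 2 ^ N * (C + D)"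
      using C[OF s, of "merid x"] D[OF s, of "merid x"] by (intro mult_left_mono add_mono) auto
    finally show ?thesis .
  qed
  then show "\<exists>C. \<forall>s\<in>K. \<forall>x. (1 + norm x) ^ N * \<bar>merid_comp u vs i s x\<bar> \<le> C"
    by blast
qed

locale axisymmetric_flow =
  fixes \<nu> :: real and I :: "real set" and u :: "(real^3) \<times> real \<Rightarrow> real^3"
    and ur uth uz :: "real \<Rightarrow> real \<Rightarrow> real \<Rightarrow> real"
  assumes openI: "open I"
    and smooth: "smooth_on_open (UNIV \<times> I) u"
    and decay: "rapidly_decaying I u"
    and ns: "navier_stokes \<nu> I u"
    and axi: "axisymmetric_components I u ur uth uz"
begin

lemma components:
  assumes "r > 0" "s \<in> I"
  shows "ur r z s = merid_comp u [] 1 s (r, z)" "uth r z s = merid_comp u [] 2 s (r, z)"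
    "uz r z s = merid_comp u [] 3 s (r, z)"
proof -
  have "u (merid (r, z), s) = ur r z s *\<^sub>R e_rad 0 + uth r z s *\<^sub>R e_ang 0 + uz r z s *\<^sub>R e_vert"
    using axi assms unfolding axisymmetric_components_def merid_eq_cyl by blast
  then show "ur r z s = merid_comp u [] 1 s (r, z)" "uth r z s = merid_comp u [] 2 s (r, z)"
    "uz r z s = merid_comp u [] 3 s (r, z)"
    by (simp_all add: merid_comp_def e_rad_def e_ang_def e_vert_def)
qed

lemma u_differentiable: "s \<in> I \<Longrightarrow> space_deriv vs u differentiable (at (x, s))"
  by (rule space_deriv_differentiable[OF smooth])

lemma u_equivariant:
  assumes "s \<in> I" "x \<in> off_axis"
  shows "u (rot \<phi> x, s) = rot \<phi> (u (x, s))"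
proof -
  obtain r \<theta> z where r: "r > 0" and x: "x = cyl r \<theta> z"
    using off_axis_cylE[OF assms(2)] by blast
  have u: "u (cyl r \<theta> z, s) = ur r z s *\<^sub>R e_rad \<theta> + uth r z s *\<^sub>R e_ang \<theta> + uz r z s *\<^sub>R e_vert" for \<theta>
    using axi assms r unfolding axisymmetric_components_def by blast
  show ?thesis
    unfolding x rot_cyl u
    by (simp add: vec_eq_iff forall_3 e_rad_def e_ang_def e_vert_def cos_add sin_add algebra_simps)
qed

lemma space_deriv1_equivariant:
  assumes "s \<in> I" "x \<in> off_axis"
  shows "space_deriv [rot \<phi> v] u (rot \<phi> x, s) = rot \<phi> (space_deriv [v] u (x, s))"
  unfolding space_deriv_Cons space_deriv_Nil
  by (rule rot_equivariant_dderiv[where f = u and g = u, OF _ _ u_equivariant[OF assms(1)] assms(2)])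
     (use u_differentiable[OF assms(1), of "[]"] in auto)

lemma space_deriv2_equivariant:
  assumes "s \<in> I" "x \<in> off_axis"
  shows "space_deriv [rot \<phi> v, rot \<phi> w] u (rot \<phi> x, s) = rot \<phi> (space_deriv [v, w] u (x, s))"
  unfolding space_deriv_Cons[of _ "[_]"]
  by (rule rot_equivariant_dderiv[where f = "space_deriv [rot \<phi> w] u" and g = "space_deriv [w] u",
        OF _ _ space_deriv1_equivariant[OF assms(1)] assms(2)])
     (use u_differentiable[OF assms(1)] in auto)

lemma space_deriv2_bilinear:
  assumes s: "s \<in> I"
  shows "space_deriv [a *\<^sub>R v + b *\<^sub>R w, a' *\<^sub>R v' + b' *\<^sub>R w'] u (x, s) =
    (a * a') *\<^sub>R space_deriv [v, v'] u (x, s) + (a * b') *\<^sub>R space_deriv [v, w'] u (x, s) +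
    (b * a') *\<^sub>R space_deriv [w, v'] u (x, s) + (b * b') *\<^sub>R space_deriv [w, w'] u (x, s)"
proof -
  have pair: "(a *\<^sub>R v + b *\<^sub>R w, 0::real) = a *\<^sub>R (v, 0) + b *\<^sub>R (w, 0)" for a b and v w :: "real^3"
    by simp
  have inner: "space_deriv [a *\<^sub>R v + b *\<^sub>R w] u y = a *\<^sub>R space_deriv [v] u y + b *\<^sub>R space_deriv [w] u y"
    if "y \<in> UNIV \<times> I" for y a b v w
  proof -
    have "u differentiable (at y)"
      using that u_differentiable[of "snd y" "[]" "fst y"] by auto
    then show ?thesis
      unfolding space_deriv_Cons space_deriv_Nil pair by (rule dderiv_linear)
  qed
  have outer: "dderiv z (space_deriv [a' *\<^sub>R v' + b' *\<^sub>R w'] u) (x, s) =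
      a' *\<^sub>R dderiv z (space_deriv [v'] u) (x, s) + b' *\<^sub>R dderiv z (space_deriv [w'] u) (x, s)" for z
  proof -
    have "dderiv z (space_deriv [a' *\<^sub>R v' + b' *\<^sub>R w'] u) (x, s) =
        dderiv z (\<lambda>y. a' *\<^sub>R space_deriv [v'] u y + b' *\<^sub>R space_deriv [w'] u y) (x, s)"
      by (rule dderiv_cong_open[of "UNIV \<times> I"])
         (use openI s inner u_differentiable in \<open>auto intro: open_Times\<close>)
    also have "\<dots> = a' *\<^sub>R dderiv z (space_deriv [v'] u) (x, s) + b' *\<^sub>R dderiv z (space_deriv [w'] u) (x, s)"
      by (rule dderiv_eqI) (intro derivative_intros differentiable_dderiv u_differentiable s)
    finally show ?thesis .
  qed
  show ?thesis
    unfolding space_deriv_Cons[of _ "[_]"] outer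
    unfolding pair dderiv_linear[OF u_differentiable[OF s]]
    by (simp add: algebra_simps)
qed

text \<open>The Laplacian is a trace, hence independent of the orthonormal frame.\<close>

lemma laplacian_equivariant:
  assumes s: "s \<in> I" and x: "x \<in> off_axis"
  shows "(\<Sum>i\<in>UNIV. dspace i (dspace i u) (rot \<phi> x, s)) = rot \<phi> (\<Sum>i\<in>UNIV. dspace i (dspace i u) (x, s))"
proof -
  have e: "dspace i (dspace i u) y = space_deriv [axis i 1, axis i 1] u y" for i y
    by (simp add: space_deriv_Cons)
  have r1: "rot \<phi> (axis 1 1) = cos \<phi> *\<^sub>R axis 1 1 + sin \<phi> *\<^sub>R axis 2 1"
    and r2: "rot \<phi> (axis 2 1) = (- sin \<phi>) *\<^sub>R axis 1 1 + cos \<phi> *\<^sub>R axis 2 1"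
    and r3: "rot \<phi> (axis 3 1) = axis 3 1"
    by (simp_all add: vec_eq_iff forall_3 axis_def)
  let ?D = "\<lambda>v w. space_deriv [v, w] u (rot \<phi> x, s)"
  have "rot \<phi> (\<Sum>i\<in>UNIV. dspace i (dspace i u) (x, s)) =
      ?D (rot \<phi> (axis 1 1)) (rot \<phi> (axis 1 1)) + ?D (rot \<phi> (axis 2 1)) (rot \<phi> (axis 2 1))
      + ?D (rot \<phi> (axis 3 1)) (rot \<phi> (axis 3 1))"
    unfolding e sum_3 linear_add[OF linear_rot] space_deriv2_equivariant[OF s x] ..
  also have "\<dots> = ((sin \<phi>)\<^sup>2 + (cos \<phi>)\<^sup>2) *\<^sub>R ?D (axis 1 1) (axis 1 1)
      + ((sin \<phi>)\<^sup>2 + (cos \<phi>)\<^sup>2) *\<^sub>R ?D (axis 2 1) (axis 2 1) + ?D (axis 3 1) (axis 3 1)"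
    unfolding r1 r2 r3 space_deriv2_bilinear[OF s]
    by (simp add: algebra_simps power2_eq_square scaleR_add_left[symmetric] scaleR_diff_left[symmetric])
  also have "\<dots> = (\<Sum>i\<in>UNIV. dspace i (dspace i u) (rot \<phi> x, s))"
    unfolding e sum_3 by simp
  finally show ?thesis ..
qed

lemma dtime_equivariant:
  assumes s: "s \<in> I" and x: "x \<in> off_axis"
  shows "dtime u (rot \<phi> x, s) = rot \<phi> (dtime u (x, s))"
proof -
  have d: "u differentiable (at (y, s))" for y
    using u_differentiable[OF s, of "[]"] by simp
  have "((\<lambda>s. rot \<phi> (u (x, s))) has_vector_derivative dtime u (rot \<phi> x, s)) (at s)"
    by (rule has_vector_derivative_transform_within_open[OF dtime_has_vector_derivative[OF d] openI s])
       (use x u_equivariant in auto)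
  moreover have "((\<lambda>s. rot \<phi> (u (x, s))) has_vector_derivative rot \<phi> (dtime u (x, s))) (at s)"
    by (rule bounded_linear.has_vector_derivative[OF bounded_linear_rot dtime_has_vector_derivative[OF d]])
  ultimately show ?thesis
    by (rule vector_derivative_unique_at)
qed

text \<open>By the momentum equation this is minus the pressure gradient. Written in terms of \<open>u\<close> alone it
  inherits the symmetry of \<open>u\<close>.\<close>

definition force :: "real^3 \<Rightarrow> real \<Rightarrow> real^3" where
  "force x s = dtime u (x, s) + (\<Sum>i\<in>UNIV. (u (x, s) $ i) *\<^sub>R dspace i u (x, s))
     - \<nu> *\<^sub>R (\<Sum>i\<in>UNIV. dspace i (dspace i u) (x, s))"

lemma force_equivariant:
  assumes s: "s \<in> I" and x: "x \<in> off_axis"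
  shows "force (rot \<phi> x) s = rot \<phi> (force x s)"
proof -
  have d: "u differentiable (at (y, s))" for y
    using u_differentiable[OF s, of "[]"] by simp
  have conv: "(\<Sum>i\<in>UNIV. (u (y, s) $ i) *\<^sub>R dspace i u (y, s)) = space_deriv [u (y, s)] u (y, s)" for y
    unfolding space_deriv_Cons space_deriv_Nil by (rule dderiv_space_expansion[OF d, symmetric])
  have "space_deriv [u (rot \<phi> x, s)] u (rot \<phi> x, s) = rot \<phi> (space_deriv [u (x, s)] u (x, s))"
    unfolding u_equivariant[OF s x] by (rule space_deriv1_equivariant[OF s x])
  then show ?thesis
    unfolding force_def conv laplacian_equivariant[OF s x] dtime_equivariant[OF s x]
    by (simp add: linear_add[OF linear_rot] linear_diff[OF linear_rot] linear_scale[OF linear_rot])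
qed

text \<open>The field \<open>force\<close> is equivariant, so the derivative of the pressure along a circle about the
  axis is constant, and this constant is \<open>- r\<close> times the swirl component of \<open>force\<close>. After a full
  turn the pressure takes its initial value; hence the constant is zero.\<close>

lemma swirl_force_zero:
  assumes r: "r > 0" and s: "s \<in> I"
  shows "force (merid (r, z)) s $ 2 = 0"
proof -
  obtain \<pi> :: "(real^3) \<times> real \<Rightarrow> real" where \<pi>: "smooth_on_open (UNIV \<times> I) \<pi>"
    and eq: "\<And>x s. s \<in> I \<Longrightarrow> dtime u (x, s) + (\<Sum>i\<in>UNIV. (u (x, s) $ i) *\<^sub>R dspace i u (x, s))
       = - (\<chi> i. dspace i \<pi> (x, s)) + \<nu> *\<^sub>R (\<Sum>i\<in>UNIV. dspace i (dspace i u) (x, s))"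
    using ns unfolding navier_stokes_def by blast
  define X where "X = merid (r, z)"
  have X: "X \<in> off_axis"
    using r by (simp add: off_axis_def X_def)
  have d: "\<pi> differentiable (at (x, s))" for x
  proof -
    have "foldr dderiv [] \<pi> differentiable (at (x, s))"
      using \<pi> s unfolding smooth_on_open_def by blast
    then show ?thesis
      by simp
  qed
  have grad: "dspace i \<pi> (x, s) = - force x s $ i" for i x
    using eq[OF s, of x] by (simp add: force_def vec_eq_iff)
  have "((\<lambda>\<phi>. \<pi> (rot \<phi> X, s)) has_real_derivative - (force X s \<bullet> quarter_turn X)) (at \<phi>)" for \<phi>
  proof -
    have "dderiv (rot \<phi> (quarter_turn X), 0) \<pi> (rot \<phi> X, s) =
        (\<Sum>i\<in>UNIV. (rot \<phi> (quarter_turn X) $ i) *\<^sub>R dspace i \<pi> (rot \<phi> X, s))"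
      by (rule dderiv_space_expansion[OF d])
    also have "\<dots> = - (rot \<phi> (force X s) \<bullet> rot \<phi> (quarter_turn X))"
      unfolding grad force_equivariant[OF s X]
      by (simp add: inner_vec_def sum_negf mult.commute del: rot_nth)
    also have "\<dots> = - (force X s \<bullet> quarter_turn X)"
      by (simp add: inner_rot)
    finally show ?thesis
      using dderiv_along_curve[where c = "\<lambda>\<phi>. rot \<phi> X" and \<tau> = \<phi>, OF d rot_has_vector_derivative]
      by (simp add: has_real_derivative_iff_has_vector_derivative)
  qed
  from DERIV_const_ratio_const[of "2 * pi" 0 "\<lambda>\<phi>. \<pi> (rot \<phi> X, s)", OF _ this]
  have "force X s \<bullet> quarter_turn X = 0"
    by simp
  then show ?thesis
    using r by (simp add: inner_vec_def sum_3 X_def)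
qed

text \<open>Both sides are the derivative at angle zero of \<open>u\<close> along the circle through the point: by the
  chain rule, and by equivariance.\<close>

lemma angular_derivative:
  assumes r: "r > 0" and s: "s \<in> I"
  shows "r *\<^sub>R space_deriv [axis 2 1] u (merid (r, z), s) = quarter_turn (u (merid (r, z), s))"
proof -
  define X where "X = merid (r, z)"
  have X: "X \<in> off_axis"
    using r by (simp add: off_axis_def X_def)
  have q: "quarter_turn X = r *\<^sub>R axis 2 1"
    by (simp add: vec_eq_iff forall_3 axis_def X_def)
  have d: "u differentiable (at (y, s))" for y
    using u_differentiable[OF s, of "[]"] by simp
  have "((\<lambda>\<phi>. u (rot \<phi> X, s)) has_vector_derivative dderiv (quarter_turn X, 0) u (X, s)) (at 0)"
    using dderiv_along_curve[where c = "\<lambda>\<phi>. rot \<phi> X" and \<tau> = 0, OF d rot_has_vector_derivative] by simp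
  then have 1: "((\<lambda>\<phi>. rot \<phi> (u (X, s))) has_vector_derivative dderiv (quarter_turn X, 0) u (X, s)) (at 0)"
    unfolding u_equivariant[OF s X] .
  have 2: "((\<lambda>\<phi>. rot \<phi> (u (X, s))) has_vector_derivative quarter_turn (u (X, s))) (at 0)"
    using rot_has_vector_derivative[of "u (X, s)" 0] by simp
  have "dderiv (quarter_turn X, 0) u (X, s) = r *\<^sub>R space_deriv [axis 2 1] u (X, s)"
    using dderiv_linear[OF d, of r "(axis 2 1, 0)" 0 0] by (simp add: q space_deriv_Cons)
  with vector_derivative_unique_at[OF 1 2] show ?thesis
    by (simp add: X_def)
qed

text \<open>The same argument for the derivative of \<open>u\<close> in the rotating direction \<open>e\<^sub>\<theta>\<close>. The term with the
  first derivative along \<open>e\<^sub>r\<close> comes from the rotation of that direction.\<close>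

lemma angular_second_derivative:
  assumes r: "r > 0" and s: "s \<in> I"
  shows "r *\<^sub>R space_deriv [axis 2 1, axis 2 1] u (merid (r, z), s) =
    space_deriv [axis 1 1] u (merid (r, z), s) + quarter_turn (space_deriv [axis 2 1] u (merid (r, z), s))"
proof -
  define X where "X = merid (r, z)"
  have X: "X \<in> off_axis"
    using r by (simp add: off_axis_def X_def)
  have q: "quarter_turn X = r *\<^sub>R axis 2 1"
    by (simp add: vec_eq_iff forall_3 axis_def X_def)
  let ?D = "\<lambda>i. space_deriv [axis i 1] u"
  have d: "?D i differentiable (at (y, s))" for i y
    using u_differentiable[OF s] .
  have along: "((\<lambda>\<phi>. ?D i (rot \<phi> X, s)) has_vector_derivative r *\<^sub>R space_deriv [axis 2 1, axis i 1] u (X, s)) (at 0)" for i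
  proof -
    have "dderiv (quarter_turn X, 0) (?D i) (X, s) = r *\<^sub>R space_deriv [axis 2 1, axis i 1] u (X, s)"
      using dderiv_linear[OF d, of r "(axis 2 1, 0)" 0 0] by (simp add: q space_deriv_Cons)
    then show ?thesis
      using dderiv_along_curve[where c = "\<lambda>\<phi>. rot \<phi> X" and \<tau> = 0, OF d[of i]
          rot_has_vector_derivative] by simp
  qed
  have rot2: "space_deriv [rot \<phi> (axis 2 1)] u y = (- sin \<phi>) *\<^sub>R ?D 1 y + cos \<phi> *\<^sub>R ?D 2 y"
    if "y \<in> UNIV \<times> {s}" for y \<phi>
  proof -
    have "(rot \<phi> (axis 2 1), 0::real) = (- sin \<phi>) *\<^sub>R (axis 1 1, 0) + cos \<phi> *\<^sub>R (axis 2 1, 0)"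
      by (simp add: vec_eq_iff forall_3 axis_def)
    moreover have "u differentiable (at y)"
      using that u_differentiable[OF s, of "[]" "fst y"] by auto
    ultimately show ?thesis
      unfolding space_deriv_Cons space_deriv_Nil by (simp only: dderiv_linear)
  qed
  have "((\<lambda>\<phi>. (- sin \<phi>) *\<^sub>R ?D 1 (rot \<phi> X, s) + cos \<phi> *\<^sub>R ?D 2 (rot \<phi> X, s)) has_vector_derivative
      - ?D 1 (X, s) + r *\<^sub>R space_deriv [axis 2 1, axis 2 1] u (X, s)) (at 0)"
    by (rule derivative_eq_intros along refl | simp)+
  then have 1: "((\<lambda>\<phi>. rot \<phi> (?D 2 (X, s))) has_vector_derivative
      - ?D 1 (X, s) + r *\<^sub>R space_deriv [axis 2 1, axis 2 1] u (X, s)) (at 0)"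
    unfolding space_deriv1_equivariant[OF s X, symmetric] by (simp add: rot2)
  have 2: "((\<lambda>\<phi>. rot \<phi> (?D 2 (X, s))) has_vector_derivative quarter_turn (?D 2 (X, s))) (at 0)"
    using rot_has_vector_derivative[of "?D 2 (X, s)" 0] by simp
  from vector_derivative_unique_at[OF 1 2] show ?thesis
    by (simp add: X_def algebra_simps)
qed

abbreviation "c1 \<equiv> (axis 1 1 :: real^3)"
abbreviation "c2 \<equiv> (axis 2 1 :: real^3)"
abbreviation "c3 \<equiv> (axis 3 1 :: real^3)"

lemma incompressibility:
  assumes r: "r > 0" and s: "s \<in> I"
  shows "merid_comp u [] 1 s (r, z) + r * merid_comp u [c1] 1 s (r, z) + r * merid_comp u [c3] 3 s (r, z) = 0"
proof -
  have "(\<Sum>i\<in>UNIV. dspace i u (merid (r, z), s) $ i) = 0"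
    using ns s unfolding navier_stokes_def by blast
  then have div: "merid_comp u [c1] 1 s (r, z) + merid_comp u [c2] 2 s (r, z) + merid_comp u [c3] 3 s (r, z) = 0"
    by (simp add: sum_3 merid_comp_def space_deriv_Cons)
  have "r * merid_comp u [c2] 2 s (r, z) = merid_comp u [] 1 s (r, z)"
    using arg_cong[OF angular_derivative[OF r s, of z], of "\<lambda>v. v $ 2"] by (simp add: merid_comp_def)
  with arg_cong[OF div, of "\<lambda>y. r * y"] show ?thesis
    by (simp add: distrib_left)
qed

text \<open>The swirl momentum equation, with the factor \<open>r\<^sup>2\<close> that clears the denominators of the angular
  derivatives.\<close>

lemma swirl_equation:
  assumes r: "r > 0" and s: "s \<in> I"
  shows "r\<^sup>2 * dtime u (merid (r, z), s) $ 2 =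
    \<nu> * (r\<^sup>2 * merid_comp u [c1, c1] 2 s (r, z) + r * merid_comp u [c1] 2 s (r, z) - merid_comp u [] 2 s (r, z)
        + r\<^sup>2 * merid_comp u [c3, c3] 2 s (r, z))
    - r\<^sup>2 * merid_comp u [] 1 s (r, z) * merid_comp u [c1] 2 s (r, z)
    - r * merid_comp u [] 1 s (r, z) * merid_comp u [] 2 s (r, z)
    - r\<^sup>2 * merid_comp u [] 3 s (r, z) * merid_comp u [c3] 2 s (r, z)"
proof -
  let ?m = "\<lambda>vs i. merid_comp u vs i s (r, z)"
  have T: "dtime u (merid (r, z), s) $ 2 = \<nu> * (?m [c1, c1] 2 + ?m [c2, c2] 2 + ?m [c3, c3] 2)
      - ?m [] 1 * ?m [c1] 2 - ?m [] 2 * ?m [c2] 2 - ?m [] 3 * ?m [c3] 2"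
    using swirl_force_zero[OF r s, of z]
    by (simp add: force_def sum_3 merid_comp_def space_deriv_Cons algebra_simps)
  have 2: "r * ?m [c2] 2 = ?m [] 1" and 1: "r * ?m [c2] 1 = - ?m [] 2"
    using arg_cong[OF angular_derivative[OF r s, of z], of "\<lambda>v. v $ 2"]
      arg_cong[OF angular_derivative[OF r s, of z], of "\<lambda>v. v $ 1"] by (simp_all add: merid_comp_def)
  have 22: "r * ?m [c2, c2] 2 = ?m [c1] 2 + ?m [c2] 1"
    using arg_cong[OF angular_second_derivative[OF r s, of z], of "\<lambda>v. v $ 2"] by (simp add: merid_comp_def)
  have A: "r * r * ?m [c2, c2] 2 = r * ?m [c1] 2 - ?m [] 2"
    unfolding mult.assoc 22 using 1 by (simp add: distrib_left)
  have B: "r * r * (?m [] 2 * ?m [c2] 2) = r * ?m [] 1 * ?m [] 2"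
    unfolding 2[symmetric] by (simp add: mult_ac)
  have C: "r\<^sup>2 * dtime u (merid (r, z), s) $ 2 =
      \<nu> * (r * r * ?m [c1, c1] 2 + r * r * ?m [c2, c2] 2 + r * r * ?m [c3, c3] 2)
      - r * r * (?m [] 1 * ?m [c1] 2) - r * r * (?m [] 2 * ?m [c2] 2) - r * r * (?m [] 3 * ?m [c3] 2)"
    unfolding T power2_eq_square by (simp add: algebra_simps)
  show ?thesis
    unfolding C unfolding A B power2_eq_square by (simp add: algebra_simps)
qed

end

section \<open>The circulation identity\<close>

context axisymmetric_flow
begin

text \<open>The circulation \<open>r u\<^sup>\<theta>\<close> at time \<open>s\<close> and its partial derivatives, continued to the whole
  meridional plane.\<close>

definition "\<gamma> s x = fst x * merid_comp u [] 2 s x"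
definition "\<gamma>r s x = merid_comp u [] 2 s x + fst x * merid_comp u [c1] 2 s x"
definition "\<gamma>z s x = fst x * merid_comp u [c3] 2 s x"
definition "\<gamma>rr s x = 2 * merid_comp u [c1] 2 s x + fst x * merid_comp u [c1, c1] 2 s x"
definition "\<gamma>zz s x = fst x * merid_comp u [c3, c3] 2 s x"

text \<open>The value of \<open>r \<Gamma>\<^sub>t\<close> that the circulation equation prescribes. It is built from space
  derivatives, so it decays rapidly, locally uniformly in time; decay of time derivatives is not
  assumed. The factor \<open>r\<close> removes the singular coefficient \<open>1 / r\<close> and is present anyway as the
  weight of the integral.\<close>

definition "\<gamma>_rhs s x = \<nu> * (fst x * \<gamma>rr s x - \<gamma>r s x + fst x * \<gamma>zz s x)
  - fst x * (merid_comp u [] 1 s x * \<gamma>r s x + merid_comp u [] 3 s x * \<gamma>z s x)"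

lemma rapid_flow:
  assumes "compact K" "K \<subseteq> I"
  shows "rapid K \<gamma>" "rapid K \<gamma>r" "rapid K \<gamma>z" "rapid K \<gamma>rr" "rapid K \<gamma>zz" "rapid K \<gamma>_rhs"
proof -
  note m = rapid_merid_comp[OF smooth decay assms]
  show 1: "rapid K \<gamma>" "rapid K \<gamma>r" "rapid K \<gamma>z" "rapid K \<gamma>rr" "rapid K \<gamma>zz"
    unfolding \<gamma>_def[abs_def] \<gamma>r_def[abs_def] \<gamma>z_def[abs_def] \<gamma>rr_def[abs_def] \<gamma>zz_def[abs_def]
    by (intro rapid_mult_fst rapid_add rapid_cmult m)+
  show "rapid K \<gamma>_rhs"
    unfolding \<gamma>_rhs_def[abs_def]
    by (intro rapid_diff rapid_cmult rapid_mult_fst rapid_add rapid_mult m 1)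
qed

lemma rapid1_merid_comp: "s \<in> I \<Longrightarrow> rapid1 (merid_comp u vs i s)"
  by (rule rapid1[OF rapid_merid_comp[OF smooth decay, of "{s}"]]) auto

lemma rapid1_flow:
  assumes "s \<in> I"
  shows "rapid1 (\<gamma> s)" "rapid1 (\<gamma>r s)" "rapid1 (\<gamma>z s)" "rapid1 (\<gamma>rr s)" "rapid1 (\<gamma>zz s)" "rapid1 (\<gamma>_rhs s)"
  using rapid_flow[of "{s}"] assms by (auto intro: rapid1)

lemma \<gamma>_has_derivative:
  assumes "s \<in> I"
  shows "(\<gamma> s has_derivative (\<lambda>h. fst h * \<gamma>r s x + snd h * \<gamma>z s x)) (at x)"
  unfolding \<gamma>_def[abs_def]
  by (rule has_derivative_eq_rhs[OF has_derivative_mult[OF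
        has_derivative_fst[OF has_derivative_ident] merid_comp_has_derivative[OF smooth assms]]])
     (simp add: fun_eq_iff \<gamma>r_def \<gamma>z_def algebra_simps)

lemma merid_comp_differentiable: "s \<in> I \<Longrightarrow> merid_comp u vs i s differentiable (at x)"
  by (rule differentiableI[OF merid_comp_has_derivative[OF smooth]])

lemma \<gamma>_partials_differentiable:
  assumes "s \<in> I"
  shows "\<gamma>r s differentiable (at x)" "\<gamma>z s differentiable (at x)"
  unfolding \<gamma>r_def[abs_def] \<gamma>z_def[abs_def]
  by (intro differentiable_add differentiable_mult merid_comp_differentiable assms
      differentiableI[OF has_derivative_fst[OF has_derivative_ident]])+

lemma \<gamma>_partial_derivatives:
  assumes "s \<in> I"
  shows "((\<lambda>r. \<gamma> s (r, z)) has_real_derivative \<gamma>r s (r, z)) (at r)"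
    "((\<lambda>z. \<gamma> s (r, z)) has_real_derivative \<gamma>z s (r, z)) (at z)"
    "((\<lambda>r. \<gamma>r s (r, z)) has_real_derivative \<gamma>rr s (r, z)) (at r)"
    "((\<lambda>z. \<gamma>z s (r, z)) has_real_derivative \<gamma>zz s (r, z)) (at z)"
  unfolding \<gamma>_def \<gamma>r_def \<gamma>z_def \<gamma>rr_def \<gamma>zz_def
  by (auto intro!: derivative_eq_intros merid_comp_dr[OF smooth assms] merid_comp_dz[OF smooth assms])

lemma \<gamma>_profile: "s \<in> I \<Longrightarrow> half_plane_profile (\<gamma> s) (\<gamma>r s) (\<gamma>z s)"
  by unfold_locales (auto intro: rapid1_flow \<gamma>_partial_derivatives)

lemma \<gamma>_time_derivative:
  assumes r: "r > 0" and s: "s \<in> I"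
  shows "((\<lambda>s. \<gamma> s (r, z)) has_real_derivative \<gamma>_rhs s (r, z) / r) (at s)"
proof -
  have "((\<lambda>s. \<gamma> s (r, z)) has_real_derivative r * dtime u (merid (r, z), s) $ 2) (at s)"
    unfolding \<gamma>_def by (auto intro!: derivative_eq_intros merid_comp_dt[OF smooth s])
  moreover have "\<gamma>_rhs s (r, z) = r\<^sup>2 * dtime u (merid (r, z), s) $ 2"
    unfolding swirl_equation[OF r s]
    by (simp add: \<gamma>_rhs_def \<gamma>r_def \<gamma>z_def \<gamma>rr_def \<gamma>zz_def algebra_simps power2_eq_square)
  ultimately show ?thesis
    using r by (simp add: power2_eq_square)
qed

lemma AE_\<gamma>_critical:
  assumes s: "s \<in> I"
  shows "AE x in lebesgue. \<gamma> s x = 0 \<longrightarrow> \<gamma>r s x = 0 \<and> \<gamma>z s x = 0"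
  using AE_critical_zeros[OF rapid_continuous[OF rapid1_flow(1)[OF s] singletonI]
      rapid_continuous[OF rapid1_flow(2)[OF s] singletonI]
      rapid_continuous[OF rapid1_flow(3)[OF s] singletonI]
      \<gamma>_partial_derivatives(1,2)[OF s]]
  by (rule AE_completion)

text \<open>Up to the factor \<open>p\<^sup>2 / 4\<close> this is \<open>r\<close> times the squared gradient of \<open>|\<Gamma>|\<^sup>p\<^sup>/\<^sup>2\<close>.\<close>

definition "dissipation p s x = \<bar>\<gamma> s x\<bar> powr (p - 2) * (fst x * ((\<gamma>r s x)\<^sup>2 + (\<gamma>z s x)\<^sup>2))"

lemma dissipation_integrable:
  assumes "p > 1" "s \<in> I"
  shows "integrable lborel (\<lambda>x. indicator half_plane x * dissipation p s x)"
proof -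
  interpret half_plane_profile "\<gamma> s" "\<gamma>r s" "\<gamma>z s"
    using \<gamma>_profile assms by blast
  show ?thesis
    unfolding dissipation_def
    by (rule power_gradient_integrable[OF rapid1_flow(4) \<gamma>_partial_derivatives(3)
        rapid1_flow(5) \<gamma>_partial_derivatives(4)]) (use assms in auto)
qed

lemma rapid1_signed_power:
  assumes "p > 1" "s \<in> I" "rapid1 f"
  shows "rapid1 (\<lambda>x. signed_power (p - 1) (\<gamma> s x) * f x)"
  by (rule rapid_mult_compose[OF continuous_signed_power rapid1_flow(1) assms(3)]) (use assms in auto)

text \<open>Tested with the signed power of \<open>\<Gamma>\<close>, the circulation equation splits into the operator of
  \<open>power_green\<close>, the derivative \<open>-2 \<nu> \<Gamma>\<^sub>r\<close> (one \<open>\<Gamma>\<^sub>r\<close> is absorbed in the divergence form of the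
  diffusion), and transport. The last two integrate to zero.\<close>

lemma swirl_force_integral:
  assumes p: "p > 1" and s: "s \<in> I"
  shows "hp_lint (\<lambda>x. signed_power (p - 1) (\<gamma> s x) * \<gamma>_rhs s x) = - \<nu> * (p - 1) * hp_lint (dissipation p s)"
proof -
  interpret half_plane_profile "\<gamma> s" "\<gamma>r s" "\<gamma>z s"
    using \<gamma>_profile s by blast
  let ?\<phi> = "\<lambda>x. signed_power (p - 1) (\<gamma> s x)"
  let ?L = "\<lambda>x. fst x * \<gamma>rr s x + \<gamma>r s x + fst x * \<gamma>zz s x"
  let ?T = "\<lambda>x. fst x * (merid_comp u [] 1 s x * \<gamma>r s x + merid_comp u [] 3 s x * \<gamma>z s x)"
  note ri = rapid1_signed_power[OF p s] rapid_add rapid_cmult rapid_mult_fst rapid_mult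
    rapid1_flow[OF s] rapid1_merid_comp[OF s]
  have green: "hp_lint (\<lambda>x. ?\<phi> x * ?L x) = - (p - 1) * hp_lint (dissipation p s)"
    using power_green_identity[OF rapid1_flow(4)[OF s] \<gamma>_partial_derivatives(3)[OF s]
        rapid1_flow(5)[OF s] \<gamma>_partial_derivatives(4)[OF s] p]
    unfolding dissipation_def[abs_def] minus_mult_left[symmetric] by linarith
  have axis: "hp_lint (\<lambda>x. ?\<phi> x * \<gamma>r s x) = 0"
    by (rule radial_power_derivative_integral[OF p]) (simp add: \<gamma>_def)
  have transport: "hp_lint (\<lambda>x. ?\<phi> x * ?T x) = 0"
    by (rule transport_integral[OF p rapid1_merid_comp[OF s] rapid1_merid_comp[OF s] merid_comp_dr[OF smooth s]
          rapid1_merid_comp[OF s] rapid1_merid_comp[OF s] merid_comp_dz[OF smooth s] incompressibility[OF _ s]])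
  have "hp_lint (\<lambda>x. ?\<phi> x * \<gamma>_rhs s x) = hp_lint (\<lambda>x. \<nu> * (?\<phi> x * ?L x) +
      ((- 2 * \<nu>) * (?\<phi> x * \<gamma>r s x) + (- 1) * (?\<phi> x * ?T x)))"
    by (rule arg_cong[of _ _ hp_lint]) (simp add: fun_eq_iff \<gamma>_rhs_def algebra_simps)
  also have "\<dots> = \<nu> * hp_lint (\<lambda>x. ?\<phi> x * ?L x) +
      ((- 2 * \<nu>) * hp_lint (\<lambda>x. ?\<phi> x * \<gamma>r s x) + (- 1) * hp_lint (\<lambda>x. ?\<phi> x * ?T x))"
    unfolding hp_lint_cmult[symmetric]
    by (subst hp_lint_add[symmetric], (intro ri)+)+ (rule refl)
  finally show ?thesis
    unfolding green axis transport by (simp add: algebra_simps)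
qed

lemma abs_powr_circulation:
  "p > 1 \<Longrightarrow> \<bar>\<gamma> s x\<bar> powr p = signed_power (p - 1) (\<gamma> s x) * \<gamma> s x"
  by (cases "\<gamma> s x = 0") (auto simp: signed_power_def powr_diff sgn_if)

lemma rapid1_power:
  assumes p: "p > 1" and s: "s \<in> I"
  shows "rapid1 (\<lambda>x. \<bar>\<gamma> s x\<bar> powr p * fst x)"
  unfolding abs_powr_circulation[OF p] mult.assoc mult.commute[of _ "fst _"]
  by (intro rapid1_signed_power p rapid_mult_fst rapid1_flow s)

text \<open>Differentiation under the integral on a compact interval of times around \<open>t\<close>, with the majorant
  supplied by the circulation equation.\<close>

lemma power_integral_derivative:
  assumes p: "p > 1" and t: "t \<in> I"
  shows "((\<lambda>s. hp_lint (\<lambda>x. \<bar>\<gamma> s x\<bar> powr p * fst x)) has_real_derivative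
    - p * \<nu> * (p - 1) * hp_lint (dissipation p t)) (at t)"
proof -
  obtain \<delta>0 where \<delta>0: "\<delta>0 > 0" "cball t \<delta>0 \<subseteq> I"
    using openI t open_contains_cball by blast
  let ?K = "cball t \<delta>0"
  have sub: "s \<in> ?K" "s \<in> I" if "s \<in> ball t \<delta>0" for s
    using that \<delta>0 by auto
  have rapid_rhs: "rapid ?K (\<lambda>s x. p * (signed_power (p - 1) (\<gamma> s x) * \<gamma>_rhs s x))"
    by (intro rapid_cmult rapid_mult_compose continuous_signed_power rapid_flow \<delta>0(2)) (use p in auto)
  obtain C where C: "\<And>s x. s \<in> ?K \<Longrightarrow>
      \<bar>p * (signed_power (p - 1) (\<gamma> s x) * \<gamma>_rhs s x)\<bar> \<le> C / (1 + norm x) ^ 4" and C0: "C \<ge> 0"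
    using rapid_bound[OF rapid_rhs, of 4] by metis
  have "((\<lambda>s. \<integral>x. indicator half_plane x * (\<bar>\<gamma> s x\<bar> powr p * fst x) \<partial>lborel) has_real_derivative
      (\<integral>x. indicator half_plane x * (p * (signed_power (p - 1) (\<gamma> t x) * \<gamma>_rhs t x)) \<partial>lborel)) (at t)"
  proof (rule has_real_derivative_integral[OF \<delta>0(1)])
    fix s assume s: "s \<in> ball t \<delta>0"
    have "rapid1 (\<lambda>x. \<bar>\<gamma> s x\<bar> powr p * fst x)"
      by (rule rapid1_power[OF p sub(2)[OF s]])
    then show "integrable lborel (\<lambda>x. indicator half_plane x * (\<bar>\<gamma> s x\<bar> powr p * fst x))"
      by (rule rapid_integrable_half_plane) simp
    fix x
    show "((\<lambda>s. indicator half_plane x * (\<bar>\<gamma> s x\<bar> powr p * fst x)) has_real_derivative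
        indicator half_plane x * (p * (signed_power (p - 1) (\<gamma> s x) * \<gamma>_rhs s x))) (at s)"
    proof (cases x)
      case (Pair r z)
      show ?thesis
      proof (cases "r > 0")
        case True
        have "((\<lambda>s. \<bar>\<gamma> s (r, z)\<bar> powr p * r) has_real_derivative
            p * signed_power (p - 1) (\<gamma> s (r, z)) * (\<gamma>_rhs s (r, z) / r) * r) (at s)"
          by (intro DERIV_cmult_right DERIV_chain2[OF abs_powr_has_derivative[OF p]]
              \<gamma>_time_derivative True sub(2)[OF s])
        then show ?thesis
          using True Pair by (simp add: mult.assoc)
      qed (use Pair in simp)
    qed
    show "\<bar>indicator half_plane x * (p * (signed_power (p - 1) (\<gamma> s x) * \<gamma>_rhs s x))\<bar>
        \<le> C * (1 / (1 + norm x) ^ 4)"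
      using C[OF sub(1)[OF s], of x] C0 by (simp add: indicator_def)
  next
    have "integrable lborel (\<lambda>x. indicator half_plane x * (p * (signed_power (p - 1) (\<gamma> t x) * \<gamma>_rhs t x)))"
      by (rule rapid_integrable_half_plane[OF rapid_rhs]) (use \<delta>0 in simp)
    then show "(\<lambda>x. indicator half_plane x * (p * (signed_power (p - 1) (\<gamma> t x) * \<gamma>_rhs t x))) \<in> borel_measurable lborel"
      by simp
  qed (intro integrable_mult_right integrable_plane_weight)
  then have "((\<lambda>s. hp_lint (\<lambda>x. \<bar>\<gamma> s x\<bar> powr p * fst x)) has_real_derivative
      p * hp_lint (\<lambda>x. signed_power (p - 1) (\<gamma> t x) * \<gamma>_rhs t x)) (at t)"
    unfolding hp_lint_cmult[symmetric] unfolding hp_lint_def .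
  then show ?thesis
    unfolding swirl_force_integral[OF p t] by (simp add: mult.assoc)
qed

section \<open>Transfer to the meridional integrals\<close>

lemma swirl_circulation:
  assumes "r > 0" "s \<in> I"
  shows "abs_pow (circulation uth) q s r z = \<bar>\<gamma> s (r, z)\<bar> powr q"
    and "abs_pow (swirl_rate uth) q s r z = r powr (- 2 * q) * \<bar>\<gamma> s (r, z)\<bar> powr q"
proof -
  show 1: "abs_pow (circulation uth) q s r z = \<bar>\<gamma> s (r, z)\<bar> powr q"
    using components(2)[OF assms, of z] by (simp add: abs_pow_def circulation_def \<gamma>_def)
  have "\<bar>swirl_rate uth r z s\<bar> = r powr (- 2) * \<bar>circulation uth r z s\<bar>"
    unfolding circulation_eq_swirl_rate[OF assms(1)] using assms(1)
    by (simp add: abs_mult powr_minus powr_realpow[symmetric] flip: powr_numeral)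
  then show "abs_pow (swirl_rate uth) q s r z = r powr (- 2 * q) * \<bar>\<gamma> s (r, z)\<bar> powr q"
    using 1 assms(1) by (simp add: abs_pow_def powr_mult powr_powr)
qed

lemma hp_rapid1:
  assumes "rapid1 f" and "\<And>r z. r > 0 \<Longrightarrow> k r z = f (r, z)"
  shows "hp_integrable k" "hp_integral k = hp_lint f"
proof -
  have i: "integrable lborel (\<lambda>x. indicator half_plane x * f x)"
    by (rule rapid_integrable_half_plane[OF assms(1)]) simp
  have e: "AE x in lebesgue. x \<in> half_plane \<longrightarrow> (case x of (r, z) \<Rightarrow> k r z) = f x"
    using assms(2) by (intro AE_I2) (auto simp: half_plane_def)
  show "hp_integrable k" "hp_integral k = hp_lint f"
    using hp_integrable_AE_eq[OF i e] hp_integral_AE_eq[OF i e] by (simp_all add: hp_lint_def)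
qed

lemma circulation_power:
  assumes p: "p > 1" and s: "s \<in> I"
  shows "hp_integrable (\<lambda>r z. abs_pow (circulation uth) p s r z * r)"
    and "hp_integral (\<lambda>r z. abs_pow (circulation uth) p s r z * r) = hp_lint (\<lambda>x. \<bar>\<gamma> s x\<bar> powr p * fst x)"
  by (rule hp_rapid1[OF rapid1_power[OF p s]], simp add: swirl_circulation(1)[OF _ s])+

lemma swirl_rate_power:
  assumes p: "p > 1" and s: "s \<in> I"
  shows "hp_integrable (\<lambda>r z. abs_pow (swirl_rate uth) p s r z * r powr (2 * p + 1))"
    and "hp_integral (\<lambda>r z. abs_pow (swirl_rate uth) p s r z * r powr (2 * p + 1)) =
      hp_lint (\<lambda>x. \<bar>\<gamma> s x\<bar> powr p * fst x)"
proof -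
  have e: "abs_pow (swirl_rate uth) p s r z * r powr (2 * p + 1) = \<bar>\<gamma> s (r, z)\<bar> powr p * fst (r, z)"
    if "r > 0" for r z
    unfolding swirl_circulation(2)[OF that s]
    using that by (simp add: powr_add powr_minus field_simps)
  show "hp_integrable (\<lambda>r z. abs_pow (swirl_rate uth) p s r z * r powr (2 * p + 1))"
    "hp_integral (\<lambda>r z. abs_pow (swirl_rate uth) p s r z * r powr (2 * p + 1)) =
      hp_lint (\<lambda>x. \<bar>\<gamma> s x\<bar> powr p * fst x)"
    by (rule hp_rapid1(1)[OF rapid1_power[OF p s]], rule e, assumption)
      (rule hp_rapid1(2)[OF rapid1_power[OF p s]], rule e, assumption)
qed

context
  fixes p t :: real
  assumes p: "p > 1" and t: "t \<in> I"
begin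

lemma AE_half_power_derivative:
  "AE x in lebesgue. ((\<lambda>y. \<bar>\<gamma> t y\<bar> powr (p / 2)) has_derivative
    (\<lambda>h. p / 2 * signed_power (p / 2 - 1) (\<gamma> t x) * (fst h * \<gamma>r t x + snd h * \<gamma>z t x))) (at x)"
  using AE_\<gamma>_critical[OF t]
proof eventually_elim
  case (elim x)
  then show ?case
    by (intro half_power_has_derivative p \<gamma>_has_derivative \<gamma>_partials_differentiable t)
qed

lemma circulation_half_power:
  "r > 0 \<Longrightarrow> abs_pow (circulation uth) (p / 2) t r z = \<bar>\<gamma> t (r, z)\<bar> powr (p / 2)"
  by (rule swirl_circulation(1)[OF _ t])

lemma swirl_rate_half_power:
  "r > 0 \<Longrightarrow> abs_pow (swirl_rate uth) (p / 2) t r z = r powr (- p) * \<bar>\<gamma> t (r, z)\<bar> powr (p / 2)"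
  using swirl_circulation(2)[OF _ t, of r "p / 2" z] by simp

lemma circulation_ae_differentiable: "hp_ae_differentiable (abs_pow (circulation uth) (p / 2) t)"
  unfolding hp_ae_differentiable_def using AE_half_power_derivative
proof eventually_elim
  case (elim x)
  then show ?case
    using circulation_gradient(1)[where g = "\<gamma> t" and f = "abs_pow (circulation uth) (p / 2) t", OF _ _ circulation_half_power]
    by (cases x) simp
qed

lemma swirl_rate_ae_differentiable: "hp_ae_differentiable (abs_pow (swirl_rate uth) (p / 2) t)"
  unfolding hp_ae_differentiable_def using AE_half_power_derivative
proof eventually_elim
  case (elim x)
  then show ?case
    using swirl_rate_gradient(1)[where g = "\<gamma> t" and f = "abs_pow (swirl_rate uth) (p / 2) t", OF _ _ swirl_rate_half_power]
    by (cases x) simp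
qed

lemma circulation_dissipation:
  shows "hp_integrable (\<lambda>r z. (norm (hp_grad (abs_pow (circulation uth) (p / 2) t) r z))\<^sup>2 * r)"
    and "hp_integral (\<lambda>r z. (norm (hp_grad (abs_pow (circulation uth) (p / 2) t) r z))\<^sup>2 * r) =
      p\<^sup>2 / 4 * hp_lint (dissipation p t)"
proof -
  let ?k = "\<lambda>r z. (norm (hp_grad (abs_pow (circulation uth) (p / 2) t) r z))\<^sup>2 * r"
  let ?f = "\<lambda>x. p\<^sup>2 / 4 * dissipation p t x"
  have i: "integrable lborel (\<lambda>x. indicator half_plane x * ?f x)"
    using integrable_mult_right[OF dissipation_integrable[OF p t], of "p\<^sup>2 / 4"] by (simp add: mult_ac)
  have e: "AE x in lebesgue. x \<in> half_plane \<longrightarrow> (case x of (r, z) \<Rightarrow> ?k r z) = ?f x"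
    using AE_half_power_derivative
  proof eventually_elim
    case (elim x)
    then show ?case
      using circulation_gradient(2)[where g = "\<gamma> t" and f = "abs_pow (circulation uth) (p / 2) t",
          OF _ _ circulation_half_power]
      by (cases x) (simp add: dissipation_def)
  qed
  show "hp_integrable ?k"
    by (rule hp_integrable_AE_eq[OF i e])
  show "hp_integral ?k = p\<^sup>2 / 4 * hp_lint (dissipation p t)"
    using hp_integral_AE_eq[OF i e] unfolding hp_lint_cmult[symmetric] unfolding hp_lint_def .
qed

lemma swirl_rate_weight:
  assumes "r > 0"
  shows "\<bar>\<gamma> t (r, z)\<bar> powr p / r = signed_power (p - 1) (\<gamma> t (r, z)) * merid_comp u [] 2 t (r, z)"
  unfolding abs_powr_circulation[OF p] using assms by (simp add: \<gamma>_def)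

text \<open>The right-hand side of \<open>swirl_rate_gradient\<close> integrated over the half-plane: the cross term
  drops out, and \<open>|\<Gamma>|\<^sup>p / r\<close> is written as a bounded power of \<open>\<Gamma>\<close> times \<open>u\<^sup>\<theta>\<close>, which shows its
  integrability up to the axis.\<close>

lemma swirl_rate_dissipation:
  shows "hp_integrable (\<lambda>r z. (norm (hp_grad (abs_pow (swirl_rate uth) (p / 2) t) r z))\<^sup>2 * r powr (2 * p + 1))"
    and "hp_integral (\<lambda>r z. (norm (hp_grad (abs_pow (swirl_rate uth) (p / 2) t) r z))\<^sup>2 * r powr (2 * p + 1)) =
      p\<^sup>2 / 4 * hp_lint (dissipation p t) +
      p\<^sup>2 * hp_lint (\<lambda>x. signed_power (p - 1) (\<gamma> t x) * merid_comp u [] 2 t x)"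
proof -
  let ?k = "\<lambda>r z. (norm (hp_grad (abs_pow (swirl_rate uth) (p / 2) t) r z))\<^sup>2 * r powr (2 * p + 1)"
  let ?A = "\<lambda>x. signed_power (p - 1) (\<gamma> t x) * \<gamma>r t x"
  let ?B = "\<lambda>x. signed_power (p - 1) (\<gamma> t x) * merid_comp u [] 2 t x"
  let ?f = "\<lambda>x. p\<^sup>2 / 4 * dissipation p t x + ((- p\<^sup>2) * ?A x + p\<^sup>2 * ?B x)"
  have iD: "integrable lborel (\<lambda>x. p\<^sup>2 / 4 * (indicator half_plane x * dissipation p t x))"
    by (intro integrable_mult_right dissipation_integrable p t)
  have rAB: "rapid1 ?A" "rapid1 ?B"
    by (intro rapid1_signed_power p t rapid1_flow rapid1_merid_comp)+
  have iA: "integrable lborel (\<lambda>x. (- p\<^sup>2) * (indicator half_plane x * ?A x))"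
    and iB: "integrable lborel (\<lambda>x. p\<^sup>2 * (indicator half_plane x * ?B x))"
    using rAB by (auto intro!: integrable_mult_right rapid_integrable_half_plane[where K = "{()}"])
  have split: "(\<lambda>x. indicator half_plane x * ?f x) = (\<lambda>x.
      p\<^sup>2 / 4 * (indicator half_plane x * dissipation p t x) +
      ((- p\<^sup>2) * (indicator half_plane x * ?A x) + p\<^sup>2 * (indicator half_plane x * ?B x)))"
    by (simp add: fun_eq_iff algebra_simps)
  have i: "integrable lborel (\<lambda>x. indicator half_plane x * ?f x)"
    unfolding split by (intro Bochner_Integration.integrable_add iD iA iB)
  have e: "AE x in lebesgue. x \<in> half_plane \<longrightarrow> (case x of (r, z) \<Rightarrow> ?k r z) = ?f x"
    using AE_half_power_derivative
  proof eventually_elim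
    case (elim x)
    show ?case
    proof (cases x)
      case (Pair r z)
      then show ?thesis
        using elim swirl_rate_gradient(2)[where g = "\<gamma> t" and f = "abs_pow (swirl_rate uth) (p / 2) t",
            OF _ _ swirl_rate_half_power, of r z "\<gamma>r t" "\<gamma>z t"]
          swirl_rate_weight[of r z]
        by (simp add: dissipation_def)
    qed
  qed
  show "hp_integrable ?k"
    by (rule hp_integrable_AE_eq[OF i e])
  have "hp_integral ?k = p\<^sup>2 / 4 * hp_lint (dissipation p t) + ((- p\<^sup>2) * hp_lint ?A + p\<^sup>2 * hp_lint ?B)"
    unfolding hp_integral_AE_eq[OF i e] split
    using iD iA iB
    by (simp only: Bochner_Integration.integral_add Bochner_Integration.integrable_add
        integral_mult_right_zero hp_lint_def)
  moreover have "hp_lint ?A = 0"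
    by (rule half_plane_profile.radial_power_derivative_integral[OF \<gamma>_profile[OF t] p]) (simp add: \<gamma>_def)
  ultimately show "hp_integral ?k = p\<^sup>2 / 4 * hp_lint (dissipation p t) + p\<^sup>2 * hp_lint ?B"
    by simp
qed

lemma swirl_rate_low_weight:
  shows "hp_integrable (\<lambda>r z. abs_pow (swirl_rate uth) p t r z * r powr (2 * p - 1))"
    and "hp_integral (\<lambda>r z. abs_pow (swirl_rate uth) p t r z * r powr (2 * p - 1)) =
      hp_lint (\<lambda>x. signed_power (p - 1) (\<gamma> t x) * merid_comp u [] 2 t x)"
proof -
  have r: "rapid1 (\<lambda>x. signed_power (p - 1) (\<gamma> t x) * merid_comp u [] 2 t x)"
    by (intro rapid1_signed_power p t rapid1_merid_comp)
  have e: "abs_pow (swirl_rate uth) p t r z * r powr (2 * p - 1) =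
      signed_power (p - 1) (\<gamma> t (r, z)) * merid_comp u [] 2 t (r, z)" if "r > 0" for r z
    unfolding swirl_circulation(2)[OF that t] swirl_rate_weight[OF that, symmetric]
    using that by (simp add: powr_add powr_diff powr_minus field_simps)
  show "hp_integrable (\<lambda>r z. abs_pow (swirl_rate uth) p t r z * r powr (2 * p - 1))"
    "hp_integral (\<lambda>r z. abs_pow (swirl_rate uth) p t r z * r powr (2 * p - 1)) =
      hp_lint (\<lambda>x. signed_power (p - 1) (\<gamma> t x) * merid_comp u [] 2 t x)"
    by (rule hp_rapid1(1)[OF r], rule e, assumption) (rule hp_rapid1(2)[OF r], rule e, assumption)
qed

lemma radial_flux_integrable:
  "hp_integrable (\<lambda>r z. ur r z t / r * abs_pow (swirl_rate uth) p t r z * r powr (2 * p + 1))"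
proof (rule hp_rapid1(1))
  show "rapid1 (\<lambda>x. signed_power (p - 1) (\<gamma> t x) * (\<gamma> t x * merid_comp u [] 1 t x))"
    by (intro rapid1_signed_power p t rapid_mult rapid1_flow rapid1_merid_comp)
  show "ur r z t / r * abs_pow (swirl_rate uth) p t r z * r powr (2 * p + 1) =
      signed_power (p - 1) (\<gamma> t (r, z)) * (\<gamma> t (r, z) * merid_comp u [] 1 t (r, z))" if "r > 0" for r z
    unfolding swirl_circulation(2)[OF that t] components(1)[OF that t] mult.assoc[symmetric]
      abs_powr_circulation[OF p, symmetric]
    using that by (simp add: powr_add powr_minus field_simps)
qed

lemma power_integrals_have_derivative:
  "((\<lambda>s. hp_integral (\<lambda>r z. abs_pow (circulation uth) p s r z * r)) has_real_derivative
    - p * \<nu> * (p - 1) * hp_lint (dissipation p t)) (at t)"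
  "((\<lambda>s. hp_integral (\<lambda>r z. abs_pow (swirl_rate uth) p s r z * r powr (2 * p + 1))) has_real_derivative
    - p * \<nu> * (p - 1) * hp_lint (dissipation p t)) (at t)"
  by (rule has_field_derivative_transform_within_open[OF power_integral_derivative[OF p t] openI t],
      simp add: circulation_power swirl_rate_power p)+

end

end

theorem theorem5p1:
  fixes p \<nu> t :: real
    and I :: "real set"
    and u :: "(real^3) \<times> real \<Rightarrow> real^3"
    and ur uth uz :: "real \<Rightarrow> real \<Rightarrow> real \<Rightarrow> real"
    and F \<Gamma> :: "real \<Rightarrow> real \<Rightarrow> real \<Rightarrow> real"
  assumes "p > 1" and "\<nu> > 0"
    and "open I" and "is_interval I"
    and "smooth_on_open (UNIV \<times> I) u"
    and "rapidly_decaying I u"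
    and "navier_stokes \<nu> I u"
    and "axisymmetric_components I u ur uth uz"
    and "F = swirl_rate uth" and "\<Gamma> = circulation uth"
    and "t \<in> I"
  shows
    \<comment> \<open>In order: all quantities are meaningful; the two integral identities; the weighted identity
      at exponent \<open>2 * p + 1\<close> is the circulation identity; the circulation identity holds.\<close>
    "(hp_ae_differentiable (abs_pow F (p / 2) t) \<and>
      hp_ae_differentiable (abs_pow \<Gamma> (p / 2) t) \<and>
      hp_integrable (\<lambda>r z. abs_pow F p t r z * r powr (2 * p + 1)) \<and>
      hp_integrable (\<lambda>r z. abs_pow \<Gamma> p t r z * r) \<and>
      hp_integrable (\<lambda>r z. (norm (hp_grad (abs_pow F (p / 2) t) r z))\<^sup>2 * r powr (2 * p + 1)) \<and>
      hp_integrable (\<lambda>r z. abs_pow F p t r z * r powr (2 * p - 1)) \<and>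
      hp_integrable (\<lambda>r z. (norm (hp_grad (abs_pow \<Gamma> (p / 2) t) r z))\<^sup>2 * r) \<and>
      hp_integrable (\<lambda>r z. ur r z t / r * abs_pow F p t r z * r powr (2 * p + 1)) \<and>
      (\<lambda>s. hp_integral (\<lambda>r z. abs_pow F p s r z * r powr (2 * p + 1))) differentiable (at t) \<and>
      (\<lambda>s. hp_integral (\<lambda>r z. abs_pow \<Gamma> p s r z * r)) differentiable (at t)) \<and>

     hp_integral (\<lambda>r z. abs_pow F p t r z * r powr (2 * p + 1)) =
       hp_integral (\<lambda>r z. abs_pow \<Gamma> p t r z * r) \<and>

     4 * (p - 1) / p\<^sup>2 *
         hp_integral (\<lambda>r z. (norm (hp_grad (abs_pow F (p / 2) t) r z))\<^sup>2 * r powr (2 * p + 1))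
       - 4 * (p - 1) * hp_integral (\<lambda>r z. abs_pow F p t r z * r powr (2 * p - 1)) =
       4 * (p - 1) / p\<^sup>2 *
         hp_integral (\<lambda>r z. (norm (hp_grad (abs_pow \<Gamma> (p / 2) t) r z))\<^sup>2 * r) \<and>

     weighted_swirl_lhs \<nu> p (2 * p + 1) uth t = circulation_lhs \<nu> p uth t \<and>
     weighted_swirl_rhs p (2 * p + 1) ur uth t = 0 \<and>

     1 / p * deriv (\<lambda>s. hp_integral (\<lambda>r z. abs_pow \<Gamma> p s r z * r)) t
       + \<nu> * (4 * (p - 1) / p\<^sup>2) *
           hp_integral (\<lambda>r z. (norm (hp_grad (abs_pow \<Gamma> (p / 2) t) r z))\<^sup>2 * r) = 0"
proof -
  interpret axisymmetric_flow \<nu> I u ur uth uz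
    by unfold_locales fact+
  note F = \<open>F = swirl_rate uth\<close> and \<Gamma> = \<open>\<Gamma> = circulation uth\<close>
  note p = \<open>p > 1\<close> and t = \<open>t \<in> I\<close>
  \<comment> \<open>All terms are expressed by \<open>D\<close>, which is the dissipation of \<open>\<Gamma>\<close> up to the factor \<open>p\<^sup>2 / 4\<close>,
    and by \<open>B\<close>, the integral of \<open>|F|\<^sup>p r\<^sup>2\<^sup>p\<^sup>-\<^sup>1\<close>.\<close>
  define D where "D = hp_lint (dissipation p t)"
  define B where "B = hp_lint (\<lambda>x. signed_power (p - 1) (\<gamma> t x) * merid_comp u [] 2 t x)"
  note deriv\<Gamma> = power_integrals_have_derivative(1)[OF p t, folded \<Gamma> D_def]
  note derivF = power_integrals_have_derivative(2)[OF p t, folded F D_def]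
  note grad\<Gamma> = circulation_dissipation(2)[OF p t, folded \<Gamma> D_def]
  note gradF = swirl_rate_dissipation(2)[OF p t, folded F D_def B_def]
  note low = swirl_rate_low_weight(2)[OF p t, folded F B_def]
  have H2: "(abs_pow F (p / 2) t r z)\<^sup>2 = abs_pow F p t r z" for r z
    by (simp add: abs_pow_def abs_powr_half_squared)
  have c: "\<nu> * (4 * (p - 1) / p\<^sup>2) * (p\<^sup>2 / 4 * D) = \<nu> * (p - 1) * D"
    using p by simp
  have circ: "circulation_lhs \<nu> p uth t = 0"
    unfolding circulation_lhs_def Let_def \<Gamma>[symmetric] DERIV_imp_deriv[OF deriv\<Gamma>] grad\<Gamma> c
    using p by simp
  have swirl: "weighted_swirl_lhs \<nu> p (2 * p + 1) uth t = 0"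
    unfolding weighted_swirl_lhs_def Let_def F[symmetric] DERIV_imp_deriv[OF derivF] gradF H2
    using p low by (simp add: field_simps power2_eq_square)
  have exchange: "4 * (p - 1) / p\<^sup>2 *
        hp_integral (\<lambda>r z. (norm (hp_grad (abs_pow F (p / 2) t) r z))\<^sup>2 * r powr (2 * p + 1))
      - 4 * (p - 1) * hp_integral (\<lambda>r z. abs_pow F p t r z * r powr (2 * p - 1)) =
      4 * (p - 1) / p\<^sup>2 *
        hp_integral (\<lambda>r z. (norm (hp_grad (abs_pow \<Gamma> (p / 2) t) r z))\<^sup>2 * r)"
    unfolding gradF grad\<Gamma> low using p by (simp add: field_simps)
  have powers: "hp_integral (\<lambda>r z. abs_pow F p t r z * r powr (2 * p + 1)) =
      hp_integral (\<lambda>r z. abs_pow \<Gamma> p t r z * r)"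
    unfolding F \<Gamma> using swirl_rate_power(2)[OF p t] circulation_power(2)[OF p t] by simp
  have rhs: "weighted_swirl_rhs p (2 * p + 1) ur uth t = 0"
    by (simp add: weighted_swirl_rhs_def)
  show ?thesis
    using deriv\<Gamma> derivF unfolding F \<Gamma>
    by (intro conjI swirl_rate_ae_differentiable circulation_ae_differentiable
        swirl_rate_power(1) circulation_power(1) swirl_rate_dissipation(1) swirl_rate_low_weight(1)
        circulation_dissipation(1) radial_flux_integrable p t powers[unfolded F \<Gamma>]
        exchange[unfolded F \<Gamma>] trans[OF swirl circ[symmetric]] rhs
        circ[unfolded circulation_lhs_def Let_def])
      (auto simp: real_differentiable_def)
qed

end
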